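(* Let $d\in\mathbb{N}$, $-2<s<d$, $m\geq 1$, and let $(x_n)_{n\in\mathbb{N}}$ be a greedy sequence of points on $\mathbb{S}^d$ with respect to $K_s$ with fixed arbitrary initial points $x_1,\dots,x_m\in\mathbb{S}^d$. Let $\omega_{N,d}$ denote the set of the first $N$ points of this sequence. Then the sequence of point sets $\{\omega_{N,d}\}_{N=1}^\infty$ is uniformly distributed on $\mathbb{S}^d$, and $$\lim_{N\to\infty}\frac{P_{K_s}(\omega_{N,d})}{N}=\mathcal{I}_{s,d}.$$
   Context: $\mathbb{S}^d\subset\mathbb{R}^{d+1}$ is the unit sphere with Euclidean norm $\|\cdot\|$, and $\sigma_d$ is the surface measure normalized by $\sigma_d(\mathbb{S}^d)=1$. The Riesz $s$-kernel is $K_s(x,y)=\operatorname{sgn}(s)\|x-y\|^{-s}$ for $s\ne0$ and $K_0(x,y)=-\log\|x-y\|$ (with value $+\infty$ at $x=y$ when $s\ge0$). For $\omega_{N,d}=\{x_1,\dots,x_N\}$ (counted with multiplicity), $P_{K}(\omega_{N,d})=\min_{x\in\mathbb{S}^d}\sum_{j=1}^N K(x,x_j)$. For $s<d$, $\mathcal{I}_{s,d}=\int_{\mathbb{S}^d}\int_{\mathbb{S}^d}K_s(x,y)\,d\sigma_d(x)\,d\sigma_d(y)$. A greedy sequence for $K_s$ with initial points $x_1,\dots,x_m$ is a sequence such that for every $N\ge m$, $x_{N+1}$ is a minimizer (any one, if not unique) over $x\in\mathbb{S}^d$ of $\sum_{i=1}^{N}K_s(x,x_i)$. Uniformly distributed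 means that the probability measures $\frac1N\sum_{j=1}^N\delta_{x_j}$ converge weak-* to $\sigma_d$ as $N\to\infty$. *)

theory Defs
  imports "HOL-Probability.Probability" "HOL-Real_Asymp.Real_Asymp"
begin

section \<open>Surface measure\<close>

abbreviation unit_sphere :: "'a::euclidean_space set" where
  "unit_sphere \<equiv> sphere 0 1"

abbreviation borel_sphere :: "'a::euclidean_space measure" where
  "borel_sphere \<equiv> restrict_space borel unit_sphere"

text \<open>
  The unnormalized surface measure of the unit sphere of an \<open>n\<close>-dimensional Euclidean space is
  the measure occurring in polar coordinates: the area of \<open>A\<close> is \<open>n\<close> times the Lebesgue
  measure of the cone \<open>{t *\<^sub>R a | 0 < t < 1, a \<in> A}\<close>, i.e. the derivative at \<open>r = 1\<close> of the
  volume of \<open>{t *\<^sub>R a | 0 < t < r, a \<in> A}\<close>. The cone is the preimage of \<open>A\<close> in the punctured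
  unit ball under \<open>sgn v = v /\<^sub>R norm v\<close>.
\<close>

definition surface_measure :: "'a::euclidean_space measure" where
  "surface_measure = scale_measure (of_nat DIM('a))
     (distr (restrict_space lborel (ball 0 1 - {0})) borel_sphere sgn)"

definition sphere_measure :: "'a::euclidean_space measure" where
  "sphere_measure =
     scale_measure (1 / emeasure (surface_measure :: 'a measure) unit_sphere) surface_measure"

lemma space_surface_measure [simp]: "space surface_measure = unit_sphere"
  by (simp add: surface_measure_def space_scale_measure space_restrict_space)

lemma sets_surface_measure [simp, measurable_cong]: "sets surface_measure = sets borel_sphere"
  by (simp add: surface_measure_def)

lemma space_sphere_measure [simp]: "space sphere_measure = unit_sphere"
  by (simp add: sphere_measure_def space_scale_measure)

lemma sets_sphere_measure [simp, measurable_cong]: "sets sphere_measure = sets borel_sphere"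
  by (simp add: sphere_measure_def)

lemma sgn_measurable_sphere:
  "sgn \<in> restrict_space lborel (ball 0 1 - {0::'a::euclidean_space}) \<rightarrow>\<^sub>M borel_sphere"
proof (rule measurable_restrict_space2)
  show "sgn \<in> space (restrict_space lborel (ball 0 1 - {0::'a})) \<rightarrow> unit_sphere"
    by (auto simp: space_restrict_space norm_sgn)
  have "(\<lambda>x::'a. x /\<^sub>R norm x) \<in> borel \<rightarrow>\<^sub>M borel"
    by measurable
  then have "sgn \<in> borel \<rightarrow>\<^sub>M (borel :: 'a measure)"
    by (simp add: sgn_div_norm[abs_def])
  then show "sgn \<in> restrict_space lborel (ball 0 1 - {0::'a}) \<rightarrow>\<^sub>M borel"
    by (intro measurable_restrict_space1) simp
qed

lemma emeasure_surface_measure: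
  fixes A :: "'a::euclidean_space set"
  assumes A: "A \<in> sets borel" "A \<subseteq> unit_sphere"
  shows "emeasure surface_measure A =
    of_nat DIM('a) * emeasure lborel {t *\<^sub>R a | t a. 0 < t \<and> t < 1 \<and> a \<in> A}"
proof -
  have eq: "sgn -` A \<inter> (ball 0 1 - {0}) = {t *\<^sub>R a | t a. 0 < t \<and> t < 1 \<and> a \<in> A}" (is "?L = ?R")
  proof (intro equalityI subsetI)
    fix v assume v: "v \<in> ?L"
    then have "v = norm v *\<^sub>R sgn v" "0 < norm v" "norm v < 1" "sgn v \<in> A"
      by (auto simp: sgn_div_norm)
    then show "v \<in> ?R" by blast
  next
    fix v assume "v \<in> ?R"
    then obtain t a where "v = t *\<^sub>R a" "0 < t" "t < 1" "a \<in> A" by blast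
    moreover from \<open>a \<in> A\<close> A have "norm a = 1" by auto
    ultimately show "v \<in> ?L" by (auto simp: sgn_div_norm)
  qed
  have "A \<in> sets (borel_sphere :: 'a measure)"
    using A by (auto simp: sets_restrict_space_iff)
  then show ?thesis
    by (simp add: surface_measure_def emeasure_distr[OF sgn_measurable_sphere]
        space_restrict_space eq[symmetric] emeasure_restrict_space)
qed

lemma emeasure_surface_measure_sphere:
  "emeasure (surface_measure :: 'a::euclidean_space measure) unit_sphere =
     ennreal (DIM('a) * unit_ball_vol DIM('a))"
proof -
  have "emeasure lborel (ball 0 1 - {0::'a}) = emeasure lborel (ball 0 (1::real) :: 'a set)"
    by (subst emeasure_Diff) auto
  moreover have "sgn -` unit_sphere \<inter> (ball 0 1 - {0::'a}) = ball 0 1 - {0}"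
    by (auto simp: norm_sgn)
  moreover have "(unit_sphere :: 'a set) \<in> sets borel_sphere"
    by (auto simp: sets_restrict_space_iff)
  ultimately show ?thesis
    by (simp add: surface_measure_def emeasure_distr[OF sgn_measurable_sphere]
        space_restrict_space emeasure_restrict_space emeasure_ball ennreal_mult
        ennreal_of_nat_eq_real_of_nat)
qed

lemma prob_space_sphere_measure: "prob_space (sphere_measure :: 'a::euclidean_space measure)"
proof (rule prob_spaceI)
  have "0 < DIM('a) * unit_ball_vol DIM('a)" by simp
  then have "ennreal (DIM('a) * unit_ball_vol DIM('a)) \<noteq> 0" by (metis ennreal_eq_0_iff not_le)
  then have "emeasure (sphere_measure :: 'a measure) unit_sphere = 1"
    unfolding sphere_measure_def emeasure_scale_measure emeasure_surface_measure_sphere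
    by (subst ennreal_divide_times) (simp only: mult_1, rule ennreal_divide_self, auto)
  then show "emeasure sphere_measure (space (sphere_measure :: 'a measure)) = 1"
    by simp
qed

section \<open>Riesz kernels, polarization and greedy sequences\<close>

definition riesz_kernel :: "real \<Rightarrow> 'a::euclidean_space \<Rightarrow> 'a \<Rightarrow> ereal" where
  "riesz_kernel s x y =
     (if s \<ge> 0 \<and> x = y then \<infinity>
      else if s = 0 then ereal (- ln (norm (x - y)))
      else ereal (sgn s * norm (x - y) powr (- s)))"

text \<open>
  Point configurations are given by their enumeration \<open>x 1, \<dots>, x N\<close>, so points are counted with
  multiplicity; the value \<open>x 0\<close> is never used. For the Riesz kernels the infimum in
  \<open>polarization\<close> is a minimum, see \<open>polarization_attained\<close> below.
\<close>

definition potential :: "('a \<Rightarrow> 'a \<Rightarrow> ereal) \<Rightarrow> (nat \<Rightarrow> 'a) \<Rightarrow> nat \<Rightarrow> 'a \<Rightarrow> ereal" where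
  "potential K x N u = (\<Sum>j=1..N. K u (x j))"

definition polarization :: "('a::euclidean_space \<Rightarrow> 'a \<Rightarrow> ereal) \<Rightarrow> (nat \<Rightarrow> 'a) \<Rightarrow> nat \<Rightarrow> ereal" where
  "polarization K x N = (INF u\<in>unit_sphere. potential K x N u)"

definition greedy_sequence ::
  "('a::euclidean_space \<Rightarrow> 'a \<Rightarrow> ereal) \<Rightarrow> nat \<Rightarrow> (nat \<Rightarrow> 'a) \<Rightarrow> bool" where
  "greedy_sequence K m x \<longleftrightarrow>
     (\<forall>n\<ge>1. x n \<in> unit_sphere) \<and>
     (\<forall>N\<ge>m. is_arg_min (potential K x N) (\<lambda>u. u \<in> unit_sphere) (x (Suc N)))"

text \<open>
  For \<open>s < DIM('a) - 1\<close> the kernel is integrable, and its values on the diagonal (where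
  \<open>real_of_ereal\<close> turns \<open>\<infinity>\<close> into \<open>0\<close>) do not matter, as points have measure zero.
\<close>

definition riesz_energy :: "'a::euclidean_space itself \<Rightarrow> real \<Rightarrow> real" where
  "riesz_energy _ s =
     (\<integral>x. (\<integral>y. real_of_ereal (riesz_kernel s x (y::'a)) \<partial>sphere_measure) \<partial>sphere_measure)"

lemma tendsto_riesz_kernel:
  fixes u y :: "'a::euclidean_space"
  shows "((\<lambda>u. riesz_kernel s u y) \<longlongrightarrow> riesz_kernel s u y) (at u)"
proof (cases "u = y")
  case False
  then have "eventually (\<lambda>u. u \<noteq> y) (at u)"
    by (auto intro!: tendsto_imp_eventually_ne tendsto_ident_at)
  then have "eventually (\<lambda>u. (if s = 0 then ereal (- ln (norm (u - y)))
      else ereal (sgn s * norm (u - y) powr (- s))) = riesz_kernel s u y) (at u)"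
    by eventually_elim (simp add: riesz_kernel_def)
  moreover have "((\<lambda>u. (if s = 0 then ereal (- ln (norm (u - y)))
      else ereal (sgn s * norm (u - y) powr (- s)))) \<longlongrightarrow> riesz_kernel s u y) (at u)"
    using False by (auto simp: riesz_kernel_def intro!: tendsto_intros)
  ultimately show ?thesis
    by (rule Lim_transform_eventually[rotated])
next
  case True
  have n: "filterlim (\<lambda>u. norm (u - y)) (at_right 0) (at u)"
    using True by (auto simp: filterlim_at eventually_at_filter intro!: tendsto_eq_intros)
  consider "s < 0" | "s = 0" | "s > 0" by linarith
  then show ?thesis
  proof cases
    case 1
    have "((\<lambda>u. norm (u - y) powr (- s)) \<longlongrightarrow> 0 powr (- s)) (at u)"
      using 1 True by (intro tendsto_powr2) (auto intro!: tendsto_eq_intros)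
    then show ?thesis
      using 1 True by (auto simp: riesz_kernel_def intro!: tendsto_eq_intros)
  next
    case 2
    have "filterlim (\<lambda>u. - ln (norm (u - y))) at_top (at u)"
      using filterlim_compose[OF ln_at_0 n] by (simp add: filterlim_uminus_at_top)
    then have "((\<lambda>u. ereal (- ln (norm (u - y)))) \<longlongrightarrow> \<infinity>) (at u)"
      by (simp add: tendsto_PInfty_eq_at_top)
    moreover have "eventually (\<lambda>u. ereal (- ln (norm (u - y))) = riesz_kernel s u y) (at u)"
      using 2 True by (auto simp: riesz_kernel_def eventually_at_filter)
    ultimately show ?thesis
      using 2 True by (auto simp: riesz_kernel_def intro: Lim_transform_eventually)
  next
    case 3
    have "filterlim (\<lambda>r::real. r powr (- s)) at_top (at_right 0)"
      using 3 by real_asymp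
    then have "filterlim (\<lambda>u. norm (u - y) powr (- s)) at_top (at u)"
      using n by (rule filterlim_compose)
    then have "((\<lambda>u. ereal (norm (u - y) powr (- s))) \<longlongrightarrow> \<infinity>) (at u)"
      by (simp add: tendsto_PInfty_eq_at_top)
    moreover have "eventually (\<lambda>u. ereal (norm (u - y) powr (- s)) = riesz_kernel s u y) (at u)"
      using 3 True by (auto simp: riesz_kernel_def eventually_at_filter)
    ultimately show ?thesis
      using 3 True by (auto simp: riesz_kernel_def intro: Lim_transform_eventually)
  qed
qed

lemma riesz_kernel_not_MInf: "riesz_kernel s u y \<noteq> - \<infinity>"
  by (simp add: riesz_kernel_def)

lemma continuous_on_potential: "continuous_on A (potential (riesz_kernel s) x N)"
proof (induction N)
  case 0
  then show ?case by (simp add: potential_def)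
next
  case (Suc N)
  have *: "potential (riesz_kernel s) x M u \<noteq> - \<infinity>" for M u
    by (induction M) (simp_all add: potential_def riesz_kernel_not_MInf)
  have "((\<lambda>u. potential (riesz_kernel s) x N u + riesz_kernel s u (x (Suc N)))
      \<longlongrightarrow> potential (riesz_kernel s) x N u + riesz_kernel s u (x (Suc N))) (at u within A)"
    if "u \<in> A" for u
    using Suc that * tendsto_within_subset[OF tendsto_riesz_kernel]
    by (intro tendsto_add_ereal_general) (auto simp: continuous_on_def riesz_kernel_not_MInf)
  then show ?case by (auto simp: continuous_on_def potential_def)
qed

lemma polarization_attained:
  fixes x :: "nat \<Rightarrow> 'a::euclidean_space"
  shows "\<exists>u\<in>unit_sphere. polarization (riesz_kernel s) x N = potential (riesz_kernel s) x N u \<and>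
    (\<forall>v\<in>unit_sphere. potential (riesz_kernel s) x N u \<le> potential (riesz_kernel s) x N v)"
proof -
  have "\<exists>u\<in>unit_sphere. \<forall>v\<in>unit_sphere.
      potential (riesz_kernel s) x N u \<le> potential (riesz_kernel s) x N v"
    by (intro continuous_attains_inf continuous_on_potential) auto
  then obtain u where u: "u \<in> unit_sphere"
    "\<forall>v\<in>unit_sphere. potential (riesz_kernel s) x N u \<le> potential (riesz_kernel s) x N v" by blast
  then have "polarization (riesz_kernel s) x N = potential (riesz_kernel s) x N u"
    unfolding polarization_def by (intro antisym INF_lower INF_greatest) auto
  with u show ?thesis by blast
qed

section \<open>Uniform distribution\<close>

text \<open>The measure \<open>(1/N) \<Sum>\<^sub>j \<delta>\<^bsub>x j\<^esub>\<close>, as the image of the uniform measure on the indices.\<close>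

definition empirical_measure :: "(nat \<Rightarrow> 'a::euclidean_space) \<Rightarrow> nat \<Rightarrow> 'a measure" where
  "empirical_measure x N = distr (uniform_count_measure {1..N}) borel_sphere x"

definition weak_star_conv_sphere ::
  "(nat \<Rightarrow> 'a::euclidean_space measure) \<Rightarrow> 'a measure \<Rightarrow> bool" where
  "weak_star_conv_sphere M L \<longleftrightarrow>
     (\<forall>f :: 'a \<Rightarrow> real. continuous_on unit_sphere f \<longrightarrow>
        (\<lambda>N. \<integral>u. f u \<partial>M N) \<longlonglongrightarrow> (\<integral>u. f u \<partial>L))"

definition uniformly_distributed :: "(nat \<Rightarrow> 'a::euclidean_space) \<Rightarrow> bool" where
  "uniformly_distributed x \<longleftrightarrow> weak_star_conv_sphere (empirical_measure x) sphere_measure"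

lemma integral_empirical_measure:
  fixes f :: "'a::euclidean_space \<Rightarrow> real"
  assumes x: "\<And>n. n \<ge> 1 \<Longrightarrow> x n \<in> unit_sphere" and f: "continuous_on unit_sphere f"
  shows "(\<integral>u. f u \<partial>empirical_measure x N) = (\<Sum>j=1..N. f (x j)) / N"
proof -
  have "x \<in> uniform_count_measure {1..N} \<rightarrow>\<^sub>M borel_sphere"
    using x by (auto simp: measurable_def space_uniform_count_measure sets_uniform_count_measure
        space_restrict_space)
  then show ?thesis
    unfolding empirical_measure_def
    by (subst integral_distr)
       (auto intro: borel_measurable_continuous_on_restrict[OF f]
         simp: uniform_count_measure_def lebesgue_integral_point_measure_finite sum_divide_distrib)
qed

end

theory Submission
  imports Defs
begin

text \<open>
  On the sphere \<open>K\<^sub>s(u, v) = g (u \<bullet> v)\<close> where \<open>g t = \<Sum>\<^sub>n c\<^sub>n t\<^sup>n\<close> for \<open>\<bar>t\<bar> < 1\<close>, and \<open>c\<^sub>n > 0\<close> for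
  \<open>n \<ge> 1\<close> because \<open>s > - 2\<close>. The mean of \<open>(x\<^sub>i \<bullet> x\<^sub>j)\<^sup>n\<close> over \<open>i, j \<le> N\<close> exceeds the corresponding
  double integral by \<open>a\<^sub>n(N) \<ge> 0\<close>, the squared distance between the degree \<open>n\<close> moments of the
  empirical measure and of the surface measure. For \<open>r < 1\<close> the bounded kernel \<open>g (r (u \<bullet> v))\<close> lies
  below \<open>K\<^sub>s + \<epsilon>\<close>, where \<open>\<epsilon>\<close> tends to \<open>0\<close> as \<open>r\<close> tends to \<open>1\<close>. Since the potential of \<open>N\<close> points
  averages to \<open>N I\<close>, the greedy choice bounds the discrete energy of the dilated kernel by
  \<open>(I + \<epsilon>) N\<^sup>2 + O(N)\<close>, which forces \<open>c\<^sub>n r\<^sup>n a\<^sub>n(N)\<close> to be eventually small. So all moments converge,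
  and the sequence is uniformly distributed by Stone-Weierstrass. Finally
  \<open>\<bar>1/N \<Sum>\<^sub>j (u \<bullet> x\<^sub>j)\<^sup>n - b\<^sub>n\<bar> \<le> sqrt a\<^sub>n(N)\<close> uniformly in \<open>u\<close>, with \<open>b\<^sub>n\<close> the mean of \<open>(u \<bullet> y)\<^sup>n\<close> over the
  sphere, so the mean potential of the dilated kernel converges uniformly and bounds the
  polarization from below.
\<close>

section \<open>Invariance and regularity of the surface measure\<close>

lemma nn_integral_lborel_translate:
  fixes f :: "'a::euclidean_space \<Rightarrow> ennreal"
  assumes "f \<in> borel_measurable borel"
  shows "(\<integral>\<^sup>+x. f (c + x) \<partial>lborel) = (\<integral>\<^sup>+x. f x \<partial>lborel)"
proof -
  have "(\<integral>\<^sup>+x. f x \<partial>lborel) = (\<integral>\<^sup>+x. f x \<partial>distr lborel borel ((+) c))"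
    by (simp add: lborel_distr_plus)
  also have "\<dots> = (\<integral>\<^sup>+x. f (c + x) \<partial>lborel)"
    using assms by (subst nn_integral_distr) auto
  finally show ?thesis by simp
qed

text \<open>The image measure \<open>\<nu>\<close> is translation-invariant because \<open>f\<close>
  is linear and onto, and it agrees with \<open>lborel\<close> on centred balls because
  \<open>f\<close> preserves norms. These two facts determine it.\<close>

lemma lborel_distr_orthogonal_transformation:
  fixes f :: "'a::euclidean_space \<Rightarrow> 'a"
  assumes f: "orthogonal_transformation f"
  shows "distr lborel borel f = lborel"
proof -
  define \<nu> where "\<nu> = distr lborel borel f"
  have f_borel [measurable]: "f \<in> borel_measurable borel"
    using f by (intro borel_measurable_continuous_onI linear_continuous_on
        linear_conv_bounded_linear[THEN iffD1] orthogonal_transformation_linear)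
  have [measurable_cong]: "sets \<nu> = sets borel" by (simp add: \<nu>_def)
  have space_\<nu> [simp]: "space \<nu> = UNIV" by (simp add: \<nu>_def)
  have vball: "f -` ball 0 r = ball 0 r" for r
    using f by (auto simp: orthogonal_transformation_norm)
  have \<nu>_ball: "emeasure \<nu> (ball 0 r) = emeasure lborel (ball (0::'a) r)" for r
    by (simp add: \<nu>_def emeasure_distr vball)
  interpret N: sigma_finite_measure \<nu>
  proof (rule sigma_finite_measure.intro, intro exI conjI)
    show "countable (range (\<lambda>n::nat. ball (0::'a) (real n)))" by simp
    show "range (\<lambda>n::nat. ball (0::'a) (real n)) \<subseteq> sets \<nu>" by (auto simp: \<nu>_def)
    show "\<Union> (range (\<lambda>n::nat. ball (0::'a) (real n))) = space \<nu>"
      using reals_Archimedean2 by (auto simp: \<nu>_def)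
    show "\<forall>a\<in>range (\<lambda>n::nat. ball (0::'a) (real n)). emeasure \<nu> a \<noteq> \<infinity>"
      using emeasure_lborel_ball_finite by (auto simp: \<nu>_ball less_top[symmetric])
  qed
  have lin: "f (x + y) = f x + f y" for x y
    using orthogonal_transformation_linear[OF f] by (rule linear_add)
  \<comment> \<open>Translating the image by \<open>c\<close> amounts to translating the source by
    the preimage \<open>g c\<close>.\<close>
  obtain g where g: "\<And>y. f (g y) = y"
    using orthogonal_transformation_surj[OF f] by (metis surj_f_inv_f)
  have trans_\<nu>: "(\<integral>\<^sup>+x. h (c + x) \<partial>\<nu>) = (\<integral>\<^sup>+x. h x \<partial>\<nu>)"
    if [measurable]: "h \<in> borel_measurable borel" for h :: "'a \<Rightarrow> ennreal" and c
  proof -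
    have "(\<integral>\<^sup>+x. h (c + x) \<partial>\<nu>) = (\<integral>\<^sup>+x. h (f (g c + x)) \<partial>lborel)"
      by (simp add: \<nu>_def nn_integral_distr lin g)
    also have "\<dots> = (\<integral>\<^sup>+x. h (f x) \<partial>lborel)"
      by (rule nn_integral_lborel_translate[where f = "\<lambda>x. h (f x)"]) simp
    also have "\<dots> = (\<integral>\<^sup>+x. h x \<partial>\<nu>)"
      by (simp add: \<nu>_def nn_integral_distr)
    finally show ?thesis .
  qed
  \<comment> \<open>A translation-invariant measure is determined by its value on one symmetric set \<open>U\<close>:
    evaluate \<open>lborel U * \<nu> B\<close> by Fubini after the shear \<open>(x, y) \<mapsto> (x, x + y)\<close>.\<close>
  interpret P: pair_sigma_finite lborel \<nu> ..
  define U where "U = ball (0::'a) 1"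
  have [measurable]: "U \<in> sets borel" by (simp add: U_def)
  have U_sym: "indicator U (x - y) = (indicator U (- x + y) :: ennreal)" for x y
    by (auto simp: U_def indicator_def norm_minus_commute)
  have "emeasure \<nu> B = emeasure lborel B" if [measurable]: "B \<in> sets borel" for B
  proof -
    have "emeasure lborel U * emeasure \<nu> B = (\<integral>\<^sup>+x. indicator U x * emeasure \<nu> B \<partial>lborel)"
      by (simp add: nn_integral_multc)
    also have "\<dots> = (\<integral>\<^sup>+x. indicator U x * (\<integral>\<^sup>+y. indicator B (x + y) \<partial>\<nu>) \<partial>lborel)"
      by (simp add: trans_\<nu>)
    also have "\<dots> = (\<integral>\<^sup>+x. (\<integral>\<^sup>+y. indicator U x * indicator B (x + y) \<partial>\<nu>) \<partial>lborel)"
      by (simp add: nn_integral_cmult)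
    also have "\<dots> = (\<integral>\<^sup>+y. (\<integral>\<^sup>+x. indicator U x * indicator B (x + y) \<partial>lborel) \<partial>\<nu>)"
      by (rule P.Fubini'[symmetric]) simp
    also have "\<dots> = (\<integral>\<^sup>+y. (\<integral>\<^sup>+x. indicator U (x - y) * indicator B x \<partial>lborel) \<partial>\<nu>)"
    proof (rule nn_integral_cong)
      fix y
      show "(\<integral>\<^sup>+x. indicator U x * indicator B (x + y) \<partial>lborel) =
          (\<integral>\<^sup>+x. indicator U (x - y) * indicator B x \<partial>lborel)"
        using nn_integral_lborel_translate[of "\<lambda>x. indicator U (x - y) * indicator B x" y]
        by (simp add: add.commute)
    qed
    also have "\<dots> = (\<integral>\<^sup>+x. (\<integral>\<^sup>+y. indicator U (x - y) * indicator B x \<partial>\<nu>) \<partial>lborel)"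
      by (rule P.Fubini') simp
    also have "\<dots> = (\<integral>\<^sup>+x. (\<integral>\<^sup>+y. indicator U (- x + y) \<partial>\<nu>) * indicator B x \<partial>lborel)"
      unfolding U_sym by (intro nn_integral_cong nn_integral_multc) measurable
    also have "\<dots> = emeasure \<nu> U * emeasure lborel B"
      by (simp add: trans_\<nu> nn_integral_cmult del: uminus_add_conv_diff)
    finally have *: "emeasure lborel U * emeasure \<nu> B = emeasure lborel U * emeasure lborel B"
      by (simp add: U_def \<nu>_ball)
    have "emeasure lborel U \<noteq> 0" "emeasure lborel U \<noteq> \<infinity>"
      unfolding U_def emeasure_ball using unit_ball_vol_pos[of "real DIM('a)"]
      by (auto simp: emeasure_ball ennreal_eq_0_iff not_le simp del: unit_ball_vol_pos)
    with * show ?thesis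
      by (simp add: ennreal_mult_cancel_left)
  qed
  then have "\<nu> = lborel"
    by (intro measure_eqI) (auto simp: \<nu>_def)
  then show ?thesis by (simp add: \<nu>_def)
qed

text \<open>Reflection in the hyperplane orthogonal to \<open>w\<close>; for \<open>w = 0\<close>
  division by zero makes it the identity.\<close>

definition reflect :: "'a::euclidean_space \<Rightarrow> 'a \<Rightarrow> 'a" where
  "reflect w v = v - (2 * (v \<bullet> w) / (w \<bullet> w)) *\<^sub>R w"

lemma orthogonal_transformation_reflect: "orthogonal_transformation (reflect w)"
  unfolding orthogonal_transformation_def
proof (intro conjI allI)
  show "linear (reflect w)"
    by (rule linearI)
       (simp_all add: reflect_def inner_add_left distrib_left add_divide_distrib algebra_simps)
  show "reflect w v \<bullet> reflect w v' = v \<bullet> v'" for v v'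
    by (cases "w = 0")
       (simp_all add: reflect_def inner_diff_left inner_diff_right inner_commute field_simps)
qed

text \<open>Equal norms force the coefficient of \<open>u - v\<close> in the reflection to be 1.
  Hence orthogonal maps act transitively on the sphere.\<close>

lemma reflect_swap:
  fixes u v :: "'a::euclidean_space"
  assumes "norm u = norm v"
  shows "reflect (u - v) u = v"
proof (cases "u = v")
  case False
  have "u \<bullet> u = v \<bullet> v" using assms by (simp add: norm_eq_sqrt_inner)
  then have "2 * (u \<bullet> (u - v)) = (u - v) \<bullet> (u - v)"
    by (simp add: inner_diff_left inner_diff_right inner_commute)
  moreover have "(u - v) \<bullet> (u - v) \<noteq> 0" using False by simp
  ultimately show ?thesis by (simp add: reflect_def)
qed (simp add: reflect_def)

section \<open>Rotation invariance and cap estimates for the surface measure\<close>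

lemma sphere_measurable_orthogonal_transformation:
  assumes f: "orthogonal_transformation f"
  shows "f \<in> borel_sphere \<rightarrow>\<^sub>M borel_sphere"
proof (rule measurable_restrict_space2)
  show "f \<in> space borel_sphere \<rightarrow> unit_sphere"
    using orthogonal_transformation_norm[OF f] by (auto simp: space_restrict_space)
  show "f \<in> borel_sphere \<rightarrow>\<^sub>M borel"
    using f by (intro measurable_restrict_space1 borel_measurable_continuous_onI linear_continuous_on
        linear_conv_bounded_linear[THEN iffD1] orthogonal_transformation_linear)
qed

lemma emeasure_sphere_measure:
  fixes A :: "'a::euclidean_space set"
  assumes "A \<in> sets borel_sphere"
  shows "emeasure sphere_measure A =
    1 / emeasure (surface_measure :: 'a measure) unit_sphere *
    (of_nat DIM('a) * emeasure lborel (sgn -` A \<inter> (ball 0 1 - {0})))"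
proof -
  have "emeasure surface_measure A = of_nat DIM('a) * emeasure lborel (sgn -` A \<inter> (ball 0 1 - {0}))"
    using assms
    by (simp add: surface_measure_def emeasure_distr[OF sgn_measurable_sphere]
        space_restrict_space emeasure_restrict_space)
  then show ?thesis by (simp add: sphere_measure_def)
qed

text \<open>\<open>f\<close> commutes with the radial projection \<open>sgn\<close> and preserves
  the punctured ball, so the cone over a preimage is the preimage of the cone, and invariance of
  \<open>lborel\<close> carries over.\<close>

lemma sphere_measure_distr_orthogonal_transformation:
  fixes f :: "'a::euclidean_space \<Rightarrow> 'a"
  assumes f: "orthogonal_transformation f"
  shows "distr sphere_measure borel_sphere f = sphere_measure"
proof (rule measure_eqI)
  fix A assume "A \<in> sets (distr sphere_measure borel_sphere f)"
  then have A: "A \<in> sets (borel_sphere :: 'a measure)" by simp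
  note fm = sphere_measurable_orthogonal_transformation[OF f]
  then have fm': "f \<in> sphere_measure \<rightarrow>\<^sub>M borel_sphere" by simp
  have fA: "f -` A \<inter> unit_sphere \<in> sets borel_sphere"
    using measurable_sets[OF fm A] by (simp add: space_restrict_space)
  have S: "sgn -` A \<inter> (ball 0 1 - {0}) \<in> sets borel"
    using measurable_sets[OF sgn_measurable_sphere A]
    by (auto simp: space_restrict_space sets_restrict_space_iff)
  have f0: "f x = 0 \<longleftrightarrow> x = 0" for x
    using orthogonal_transformation_norm[OF f, of x] by auto
  have sg: "sgn (f x) = f (sgn x)" for x
    using f by (simp add: sgn_div_norm orthogonal_transformation_norm orthogonal_transformation_scaleR)
  have f_borel: "f \<in> borel_measurable borel"
    using f by (intro borel_measurable_continuous_onI linear_continuous_on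
        linear_conv_bounded_linear[THEN iffD1] orthogonal_transformation_linear)
  have "emeasure lborel (sgn -` (f -` A \<inter> unit_sphere) \<inter> (ball 0 1 - {0})) =
      emeasure lborel (f -` (sgn -` A \<inter> (ball 0 1 - {0})))"
    by (rule arg_cong[where f = "emeasure lborel"])
       (auto simp: sg f0 orthogonal_transformation_norm[OF f] norm_sgn)
  also have "\<dots> = emeasure (distr lborel borel f) (sgn -` A \<inter> (ball 0 1 - {0}))"
    using S f_borel by (subst emeasure_distr) auto
  also have "\<dots> = emeasure lborel (sgn -` A \<inter> (ball 0 1 - {0}))"
    by (simp add: lborel_distr_orthogonal_transformation[OF f])
  finally show "emeasure (distr sphere_measure borel_sphere f) A = emeasure sphere_measure A"
    using A fA by (simp add: emeasure_distr[OF fm'] emeasure_sphere_measure)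
qed simp

text \<open>The exponent is the dimension of the sphere, which is what excludes atoms and makes the
  kernel integrable. The centre is a basis vector so that the enclosing box is parallel to the axes;
  rotation invariance later transfers the consequences to other points.\<close>

lemma sphere_measure_cap_le:
  fixes b :: "'a::euclidean_space"
  assumes b: "b \<in> Basis" and r: "0 \<le> r"
  shows "emeasure sphere_measure (unit_sphere \<inter> cball b r) \<le>
    ennreal (2 * (2 * r) ^ (DIM('a) - 1) / unit_ball_vol DIM('a))"
proof -
  define q where "q = b + (\<Sum>i\<in>Basis - {b}. r *\<^sub>R i)"
  have qi: "q \<bullet> i = (if i = b then 1 else r)" if "i \<in> Basis" for i
    using that b
    by (auto simp: q_def inner_add_left inner_sum_left inner_Basis if_distrib sum.delta cong: if_cong)
  \<comment> \<open>The cone over the cap lies in a box with one long side, along \<open>b\<close>.\<close>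
  have "sgn -` (unit_sphere \<inter> cball b r) \<inter> (ball 0 1 - {0}) \<subseteq> cbox (- q) q"
  proof
    fix v assume v: "v \<in> sgn -` (unit_sphere \<inter> cball b r) \<inter> (ball 0 1 - {0::'a})"
    then have n: "0 < norm v" "norm v < 1" "norm (sgn v - b) \<le> r"
      by (auto simp: dist_norm norm_minus_commute)
    have "\<bar>v \<bullet> i\<bar> \<le> q \<bullet> i" if i: "i \<in> Basis" for i
    proof (cases "i = b")
      case True
      then show ?thesis using Basis_le_norm[OF i, of v] n qi[OF i] by simp
    next
      case False
      then have "b \<bullet> i = 0" using b i by (simp add: inner_Basis)
      then have "\<bar>sgn v \<bullet> i\<bar> \<le> r"
        using Basis_le_norm[OF i, of "sgn v - b"] n by (simp add: inner_diff_left)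
      moreover have "v \<bullet> i = norm v * (sgn v \<bullet> i)"
        using n by (simp add: sgn_div_norm)
      ultimately show ?thesis
        using n qi[OF i] False mult_mono[of "norm v" 1 "\<bar>sgn v \<bullet> i\<bar>" r]
        by (simp add: abs_mult)
    qed
    then show "v \<in> cbox (- q) q"
      by (force simp: mem_box)
  qed
  then have "emeasure lborel (sgn -` (unit_sphere \<inter> cball b r) \<inter> (ball 0 1 - {0})) \<le>
      emeasure lborel (cbox (- q) q)"
    by (intro emeasure_mono) auto
  also have "\<dots> = ennreal (\<Prod>i\<in>Basis. (q - - q) \<bullet> i)"
    by (rule emeasure_lborel_cbox) (use qi r in \<open>auto split: if_splits\<close>)
  also have "(\<Prod>i\<in>Basis. (q - - q) \<bullet> i) = (\<Prod>i\<in>Basis. if i = b then 2 else 2 * r)"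
    by (rule prod.cong) (auto simp: qi inner_diff_left inner_add_left)
  also have "\<dots> = 2 * (2 * r) ^ (DIM('a) - 1)"
    using b by (subst prod.remove[of _ b]) (auto simp: prod.If_cases card_Diff_singleton)
  finally have le: "emeasure lborel (sgn -` (unit_sphere \<inter> cball b r) \<inter> (ball 0 1 - {0})) \<le>
      ennreal (2 * (2 * r) ^ (DIM('a) - 1))" .
  have "unit_sphere \<inter> cball b r \<in> sets (borel_sphere :: 'a measure)"
    by (auto simp: sets_restrict_space_iff)
  then have "emeasure sphere_measure (unit_sphere \<inter> cball b r) \<le>
      1 / ennreal (DIM('a) * unit_ball_vol DIM('a)) *
        (of_nat DIM('a) * ennreal (2 * (2 * r) ^ (DIM('a) - 1)))"
    unfolding emeasure_surface_measure_sphere[symmetric]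
    by (simp only: emeasure_sphere_measure) (intro mult_left_mono le; simp)
  also have "\<dots> = ennreal (1 / (DIM('a) * unit_ball_vol DIM('a)) *
        (DIM('a) * (2 * (2 * r) ^ (DIM('a) - 1))))"
  proof -
    have "1 / ennreal (DIM('a) * unit_ball_vol DIM('a)) =
        ennreal (1 / (DIM('a) * unit_ball_vol DIM('a)))"
      by (subst divide_ennreal[symmetric]) auto
    moreover have "ennreal p * (of_nat n * ennreal q) = ennreal (p * (real n * q))"
      if "0 \<le> p" "0 \<le> q" for p q n
      using that by (simp add: ennreal_mult ennreal_of_nat_eq_real_of_nat)
    ultimately show ?thesis using r by simp
  qed
  also have "1 / (DIM('a) * unit_ball_vol DIM('a)) * (DIM('a) * (2 * (2 * r) ^ (DIM('a) - 1))) =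
      2 * (2 * r) ^ (DIM('a) - 1) / unit_ball_vol DIM('a)"
    by simp
  finally show ?thesis .
qed

section \<open>The Riesz kernel on the sphere\<close>

text \<open>
  The Riesz kernel as a function of \<open>t = u \<bullet> v\<close>, using \<open>norm (u - v) ^ 2 = 2 - 2 * t\<close>. For \<open>s \<ge> 0\<close>
  the value at \<open>t = 1\<close> is the junk value \<open>0\<close>, as for \<open>real_of_ereal \<infinity>\<close>.
\<close>

definition riesz_profile :: "real \<Rightarrow> real \<Rightarrow> real" where
  "riesz_profile s t =
     (if s = 0 then - ln (2 - 2 * t) / 2 else sgn s * (2 - 2 * t) powr (- s / 2))"

text \<open>The Taylor coefficients of \<open>riesz_profile s\<close> at 0, from the logarithmic
  series for \<open>s = 0\<close> and the binomial series otherwise.\<close>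

definition riesz_coeff :: "real \<Rightarrow> nat \<Rightarrow> real" where
  "riesz_coeff s n =
     (if s = 0 then (if n = 0 then - ln 2 / 2 else 1 / (2 * real n))
      else sgn s * 2 powr (- s / 2) * pochhammer (s / 2) n / fact n)"

section \<open>Inner-product form and power series of the kernel\<close>

lemma norm_diff_sphere:
  fixes u v :: "'a::euclidean_space"
  assumes "norm u = 1" "norm v = 1"
  shows "(norm (u - v))\<^sup>2 = 2 - 2 * (u \<bullet> v)"
proof -
  have "u \<bullet> u = 1" "v \<bullet> v = 1" using assms by (simp_all add: dot_square_norm)
  then show ?thesis
    by (simp add: power2_norm_eq_inner inner_diff_left inner_diff_right inner_commute)
qed

lemma inner_sphere_eq_1_iff:
  fixes u v :: "'a::euclidean_space"
  assumes "norm u = 1" "norm v = 1"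
  shows "u \<bullet> v = 1 \<longleftrightarrow> u = v"
  using norm_diff_sphere[OF assms] assms by (auto simp: dot_square_norm)

lemma inner_sphere_bounds:
  fixes u v :: "'a::euclidean_space"
  assumes "norm u = 1" "norm v = 1"
  shows "- 1 \<le> u \<bullet> v" "u \<bullet> v \<le> 1" "\<bar>u \<bullet> v\<bar> \<le> 1"
  using Cauchy_Schwarz_ineq2[of u v] assms by auto

lemma riesz_kernel_sphere:
  fixes u v :: "'a::euclidean_space"
  assumes "norm u = 1" "norm v = 1"
  shows "riesz_kernel s u v =
    (if s \<ge> 0 \<and> u = v then \<infinity> else ereal (riesz_profile s (u \<bullet> v)))"
proof -
  have n: "2 - 2 * (u \<bullet> v) = (norm (u - v))\<^sup>2" using norm_diff_sphere[OF assms] by simp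
  show ?thesis
  proof (cases "u = v")
    case True
    have "v \<bullet> v = 1" using assms by (simp add: dot_square_norm)
    with True show ?thesis by (simp add: riesz_kernel_def riesz_profile_def)
  next
    case False
    then have "ln ((norm (u - v))\<^sup>2) = 2 * ln (norm (u - v))" 
      by (simp add: ln_realpow)
    moreover have "((norm (u - v))\<^sup>2) powr (- s / 2) = norm (u - v) powr (- s)"
      using False by (simp add: powr_powr flip: powr_numeral)
    ultimately show ?thesis
      using False unfolding riesz_kernel_def riesz_profile_def n by simp
  qed
qed

lemma real_of_ereal_riesz_kernel:
  fixes u v :: "'a::euclidean_space"
  assumes "norm u = 1" "norm v = 1"
  shows "real_of_ereal (riesz_kernel s u v) = riesz_profile s (u \<bullet> v)"
  using assms inner_sphere_eq_1_iff[OF assms]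
  by (auto simp: riesz_kernel_sphere riesz_profile_def)

text \<open>Factor \<open>2 - 2 * t = 2 * (1 - t)\<close> and use the known series at
  \<open>- t\<close>; the alternating signs of the generalized binomial coefficients cancel, leaving
  a rising factorial.\<close>

lemma riesz_profile_sums:
  assumes t: "\<bar>t\<bar> < 1"
  shows "(\<lambda>n. riesz_coeff s n * t ^ n) sums riesz_profile s t"
proof (cases "s = 0")
  case True
  have "(\<lambda>n. - ((- (- t)) ^ n) / of_nat n) sums ln (1 + - t)"
    using t by (intro ln_series') simp
  from sums_mult[OF this, of "- 1 / 2"]
  have "(\<lambda>n. t ^ n / (2 * of_nat n)) sums (- ln (1 - t) / 2)" by simp
  \<comment> \<open>The term \<open>n = 0\<close> of the series above is \<open>1 / 0 = 0\<close>,
    so the constant term is added separately.\<close>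
  moreover have "(\<lambda>n. if n = 0 then - ln 2 / 2 else 0) sums (- ln 2 / 2 :: real)"
    by (rule sums_single)
  ultimately have "(\<lambda>n. t ^ n / (2 * of_nat n) + (if n = 0 then - ln 2 / 2 else 0)) sums
      (- ln (1 - t) / 2 + - ln 2 / 2)"
    by (rule sums_add)
  moreover have "ln (2 - 2 * t) = ln 2 + ln (1 - t)"
    using t ln_mult[of 2 "1 - t"] by (simp add: algebra_simps)
  moreover have "t ^ n / (2 * of_nat n) + (if n = 0 then - ln 2 / 2 else 0) =
      riesz_coeff s n * t ^ n" for n
    using True by (simp add: riesz_coeff_def)
  ultimately show ?thesis
    using True by (simp add: riesz_profile_def diff_divide_distrib add.commute)
next
  case False
  have "(\<lambda>n. ((- s / 2) gchoose n) * (- t) ^ n) sums (1 + - t) powr (- s / 2)"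
    using t by (intro gen_binomial_real) simp
  from sums_mult[OF this, of "sgn s * 2 powr (- s / 2)"]
  have *: "(\<lambda>n. sgn s * 2 powr (- s / 2) * (((- s / 2) gchoose n) * (- t) ^ n)) sums
      (sgn s * 2 powr (- s / 2) * (1 - t) powr (- s / 2))" by simp
  have "2 powr (- s / 2) * (1 - t) powr (- s / 2) = (2 - 2 * t) powr (- s / 2)"
    using t by (subst powr_mult[symmetric]) (auto simp: algebra_simps)
  moreover have "sgn s * 2 powr (- s / 2) * (((- s / 2) gchoose n) * (- t) ^ n) =
      riesz_coeff s n * t ^ n" for n
  proof -
    have "(- 1) ^ n * (- t) ^ n = t ^ n" by (simp flip: power_mult_distrib)
    then have "((- s / 2) gchoose n) * (- t) ^ n = pochhammer (s / 2) n / fact n * t ^ n"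
      by (simp add: gbinomial_pochhammer mult.assoc mult.left_commute)
    then show ?thesis using False by (simp add: riesz_coeff_def)
  qed
  ultimately show ?thesis
    using * False by (simp add: riesz_profile_def mult.assoc)
qed

text \<open>For \<open>s \<noteq> 0\<close> the factor \<open>sgn s\<close> compensates the sign of
  the first factor \<open>s / 2\<close> of the rising factorial; the others start at
  \<open>s / 2 + 1\<close>, which is positive because \<open>s > - 2\<close>.\<close>

lemma riesz_coeff_pos:
  assumes "- 2 < s" "n \<ge> 1"
  shows "riesz_coeff s n > 0"
proof -
  obtain k where k: "n = Suc k" using assms by (cases n) auto
  have "s / 2 * pochhammer (s / 2 + 1) k * sgn s > 0" if "s \<noteq> 0"
  proof -
    have "pochhammer (s / 2 + 1) k > 0" using assms by (intro pochhammer_pos) simp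
    moreover have "s * sgn s > 0" using that by (simp flip: abs_sgn)
    ultimately show ?thesis by (auto simp: zero_less_mult_iff mult_less_0_iff)
  qed
  then show ?thesis
    using assms by (auto simp: riesz_coeff_def k pochhammer_rec mult.commute mult.left_commute
        zero_less_mult_iff intro!: divide_pos_pos)
qed

section \<open>Monotonicity of the profile and comparison with its dilations\<close>

lemma riesz_profile_mono:
  assumes "t \<le> t'" "t' < 1"
  shows "riesz_profile s t \<le> riesz_profile s t'"
proof -
  consider "s = 0" | "s > 0" | "s < 0" by linarith
  then show ?thesis
  proof cases
    case 2
    then show ?thesis using assms powr_mono2'[of "- s / 2" "2 - 2 * t'" "2 - 2 * t"]
      by (simp add: riesz_profile_def)
  next
    case 3
    then show ?thesis using assms powr_mono2[of "- s / 2" "2 - 2 * t'" "2 - 2 * t"]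
      by (simp add: riesz_profile_def)
  qed (use assms in \<open>simp add: riesz_profile_def\<close>)
qed

lemma continuous_on_riesz_profile: "continuous_on {..<1} (riesz_profile s)"
  unfolding riesz_profile_def[abs_def]
  by (cases "s = 0") (auto intro!: continuous_intros)

lemma borel_measurable_riesz_profile [measurable]: "riesz_profile s \<in> borel_measurable borel"
  unfolding riesz_profile_def[abs_def] by measurable

text \<open>For \<open>t \<ge> 0\<close> dilation moves \<open>t\<close> to the left and
  monotonicity gives the bound without error. For \<open>t < 0\<close> it moves \<open>t\<close> to
  the right, but there uniform continuity on \<open>{- 1..0}\<close>, away from the singularity,
  controls the change.\<close>

lemma riesz_profile_dilation_le:
  assumes "\<epsilon> > 0"
  shows "\<forall>\<^sub>F r in at_left 1. \<forall>t\<in>{- 1..<1}. riesz_profile s (r * t) \<le> riesz_profile s t + \<epsilon>"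
proof -
  have "uniformly_continuous_on {- 1..0} (riesz_profile s)"
    by (intro compact_uniformly_continuous continuous_on_subset[OF continuous_on_riesz_profile]) auto
  then obtain \<delta> where \<delta>: "\<delta> > 0"
    "\<And>t t'. t \<in> {- 1..0} \<Longrightarrow> t' \<in> {- 1..0} \<Longrightarrow> dist t' t < \<delta> \<Longrightarrow>
      dist (riesz_profile s t') (riesz_profile s t) < \<epsilon>"
    using assms unfolding uniformly_continuous_on_def by metis
  have "\<forall>\<^sub>F r in at_left (1::real). r \<in> {max 0 (1 - \<delta>)<..<1}"
    using \<delta>(1) by (intro eventually_at_leftI[of "max 0 (1 - \<delta>)"]) auto
  then show ?thesis
  proof eventually_elim
    case (elim r)
    show ?case
    proof
      fix t :: real assume t: "t \<in> {- 1..<1}"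
      show "riesz_profile s (r * t) \<le> riesz_profile s t + \<epsilon>"
      proof (cases "t \<ge> 0")
        case True
        then have "riesz_profile s (r * t) \<le> riesz_profile s t"
          using elim t by (intro riesz_profile_mono) (auto intro: mult_left_le_one_le)
        then show ?thesis using assms by simp
      next
        case False
        have "\<bar>r * t - t\<bar> = \<bar>(1 - r) * (- t)\<bar>"
          by (simp add: algebra_simps)
        also have "\<dots> = (1 - r) * (- t)"
          using elim False by (intro abs_of_nonneg mult_nonneg_nonneg) auto
        also have "\<dots> \<le> (1 - r) * 1" using elim t False by (intro mult_left_mono) auto
        finally have "\<bar>r * t - t\<bar> < \<delta>" using elim by auto
        moreover have "- 1 \<le> r * t" 
          using elim t False mult_mono[of r 1 "- t" 1] by auto
        moreover have "r * t \<le> 0" using elim False by (simp add: mult_nonneg_nonpos)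
        ultimately have "dist (riesz_profile s (r * t)) (riesz_profile s t) < \<epsilon>"
          using t False by (intro \<delta>(2)) (auto simp: dist_real_def)
        then show ?thesis by (simp add: dist_real_def)
      qed
    qed
  qed
qed

lemma riesz_kernel_dilation_le:
  assumes "\<epsilon> > 0" "- 2 < s"
  shows "\<forall>\<^sub>F r in at_left 1. \<forall>u v::'a::euclidean_space. norm u = 1 \<longrightarrow> norm v = 1 \<longrightarrow>
    ereal (riesz_profile s (r * (u \<bullet> v)) - \<epsilon>) \<le> riesz_kernel s u v"
proof -
  have "\<forall>\<^sub>F r in at_left (1::real). r < 1" by (auto simp: eventually_at_filter)
  with riesz_profile_dilation_le[OF assms(1), of s] show ?thesis
  proof eventually_elim
    case (elim r)
    show ?case
    proof (intro allI impI)
      fix u v :: 'a assume uv: "norm u = 1" "norm v = 1"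
      show "ereal (riesz_profile s (r * (u \<bullet> v)) - \<epsilon>) \<le> riesz_kernel s u v"
      proof (cases "u = v")
        case True
        \<comment> \<open>On the diagonal the kernel is infinite for \<open>s \<ge> 0\<close>; for
          \<open>s < 0\<close> it is 0 while the dilated profile is at most 0.\<close>
        have "v \<bullet> v = 1" using uv by (simp add: dot_square_norm)
        then show ?thesis
          using True uv assms(1) by (simp add: riesz_kernel_sphere riesz_profile_def sgn_if)
             (smt (verit) powr_ge_zero)
      next
        case False
        then have "u \<bullet> v \<in> {- 1..<1}"
          using inner_sphere_bounds[OF uv] inner_sphere_eq_1_iff[OF uv] by force
        then show ?thesis using elim False uv by (auto simp: riesz_kernel_sphere algebra_simps)
      qed
    qed
  qed
qed

section \<open>Zonal integrals, absence of atoms and integrability of the kernel\<close>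

lemma measurable_inner_sphere [measurable]:
  "(\<lambda>y. u \<bullet> y) \<in> borel_measurable (sphere_measure :: 'a::euclidean_space measure)"
proof -
  have "(\<lambda>y. u \<bullet> y) \<in> borel_measurable borel" by measurable
  from measurable_restrict_space1[OF this, of unit_sphere] show ?thesis
    by (simp add: measurable_cong_sets[OF sets_sphere_measure refl])
qed

text \<open>Change variables by the reflection that takes \<open>u\<close> to \<open>v\<close>.
  Integrals of zonal functions can thus be studied with a basis vector as pole.\<close>

lemma
  fixes u v :: "'a::euclidean_space" and h :: "real \<Rightarrow> real"
  assumes uv: "norm u = norm v" and h [measurable]: "h \<in> borel_measurable borel"
  shows sphere_integral_inner: "(\<integral>y. h (u \<bullet> y) \<partial>sphere_measure) = (\<integral>y. h (v \<bullet> y) \<partial>sphere_measure)"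
    and sphere_integrable_inner: "integrable sphere_measure (\<lambda>y. h (v \<bullet> y)) \<Longrightarrow>
      integrable sphere_measure (\<lambda>y. h (u \<bullet> y))"
proof -
  define T where "T = reflect (u - v)"
  have T: "orthogonal_transformation T" "T u = v"
    unfolding T_def by (auto intro: orthogonal_transformation_reflect reflect_swap uv)
  have eq: "u \<bullet> y = v \<bullet> T y" for y
    using T unfolding orthogonal_transformation_def by metis
  have Tm: "T \<in> sphere_measure \<rightarrow>\<^sub>M borel_sphere"
    using sphere_measurable_orthogonal_transformation[OF T(1)] by simp
  have hm: "(\<lambda>y. h (v \<bullet> y)) \<in> borel_measurable borel_sphere"
    by (rule measurable_restrict_space1) measurable
  note D = sphere_measure_distr_orthogonal_transformation[OF T(1)]
  show "(\<integral>y. h (u \<bullet> y) \<partial>sphere_measure) = (\<integral>y. h (v \<bullet> y) \<partial>sphere_measure)"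
    using integral_distr[OF Tm hm] by (simp add: D eq)
  show "integrable sphere_measure (\<lambda>y. h (u \<bullet> y))"
    if "integrable sphere_measure (\<lambda>y. h (v \<bullet> y))"
    using integrable_distr_eq[OF Tm hm] that by (simp add: D eq)
qed

text \<open>The cap bound tends to 0 with the radius because the sphere has dimension at least 1, so
  a basis vector is not an atom; rotation invariance extends this to every point.\<close>

lemma AE_sphere_measure_neq:
  fixes b :: "'a::euclidean_space"
  assumes b: "norm b = 1" and dim: "DIM('a) \<ge> 2"
  shows "AE y in sphere_measure. y \<noteq> b"
proof -
  interpret prob_space "sphere_measure :: 'a measure" by (rule prob_space_sphere_measure)
  obtain e :: 'a where e: "e \<in> Basis" using nonempty_Basis by blast
  define D where "D = (DIM('a) - 1)"
  have D: "D \<ge> 1" using dim by (simp add: D_def)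
  have ball_vol: "unit_ball_vol DIM('a) \<noteq> 0"
    by (metis unit_ball_vol_pos of_nat_0_le_iff less_irrefl)
  have "prob {e} \<le> 2 * (2 * r) ^ D / unit_ball_vol DIM('a)" if "r > 0" for r
  proof -
    have "{e} \<subseteq> unit_sphere \<inter> cball e r" using e that by simp
    then have "emeasure sphere_measure {e} \<le> emeasure sphere_measure (unit_sphere \<inter> cball e r)"
      by (intro emeasure_mono) (auto simp: sets_restrict_space_iff)
    also have "\<dots> \<le> ennreal (2 * (2 * r) ^ D / unit_ball_vol DIM('a))"
      unfolding D_def using that by (intro sphere_measure_cap_le e) simp
    finally show ?thesis using that by (simp add: emeasure_eq_measure)
  qed
  then have "\<forall>\<^sub>F r in at_right 0. prob {e} \<le> 2 * (2 * r) ^ D / unit_ball_vol DIM('a)"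
    by (auto simp: eventually_at_filter)
  moreover have "((\<lambda>r. 2 * (2 * r) ^ D / unit_ball_vol DIM('a)) \<longlongrightarrow> 2 * (2 * 0) ^ D / unit_ball_vol DIM('a))
      (at_right 0)"
    using ball_vol by (intro tendsto_intros) auto
  ultimately have "prob {e} \<le> 2 * (2 * 0) ^ D / unit_ball_vol DIM('a)"
    by (intro tendsto_lowerbound) auto
  then have "prob {e} = 0" using D by (simp add: power_0_left measure_le_0_iff)
  \<comment> \<open>Singletons become zonal functions, since \<open>b \<bullet> y = 1\<close> only
    for \<open>y = b\<close>; this makes \<open>sphere_integral_inner\<close> applicable.\<close>
  have "indicator {1} (b \<bullet> y) = (indicator {b} y :: real)" if "norm b = 1" "norm y = 1" for b y :: 'a
    using inner_sphere_eq_1_iff[OF that] by (auto simp: indicator_def)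
  then have ind: "(\<integral>y. indicator {1} (b \<bullet> y) \<partial>sphere_measure) = prob {b}" if "norm b = 1" for b :: 'a
    using that by (subst Bochner_Integration.integral_cong[where g = "indicator {b}", OF refl])
      (auto simp: sets_restrict_space_iff)
  have "prob {b} = prob {e}"
    using sphere_integral_inner[of b e "indicator {1}"] b e by (simp add: ind)
  with \<open>prob {e} = 0\<close> have "emeasure sphere_measure {b} = 0" by (simp add: emeasure_eq_measure)
  then show ?thesis
    using b by (intro AE_I[where N = "{b}"]) (auto simp: sets_restrict_space_iff)
qed

lemma integrable_norm_powr_sphere:
  fixes b :: "'a::euclidean_space"
  assumes b: "b \<in> Basis" and p: "0 \<le> p" "p < real (DIM('a) - 1)"
  shows "integrable sphere_measure (\<lambda>y. norm (b - y) powr (- p))"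
proof -
  define D where "D = (DIM('a) - 1)"
  define C where "C = 2 * 4 ^ D / unit_ball_vol DIM('a)"
  have C: "C \<ge> 0" by (simp add: C_def)
  \<comment> \<open>The factor 2 makes \<open>E 0\<close> the whole sphere, and the least
    \<open>k\<close> with \<open>(1/2) ^ k < norm (b - y)\<close> then satisfies
    \<open>y \<in> E k\<close>.\<close>
  define E where "E k = unit_sphere \<inter> cball b (2 * (1/2) ^ k)" for k :: nat
  have E_sets [measurable]: "E k \<in> sets (sphere_measure :: 'a measure)" for k
    by (auto simp: E_def sets_restrict_space_iff)
  \<comment> \<open>The ratio of the dominating geometric series: weight
    \<open>2 powr (p * k)\<close> times cap measure of order \<open>2 powr (- (D * k))\<close>. It
    is below 1 because \<open>p < D\<close>.\<close>
  define q where "q = 2 powr (p - D)"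
  have q: "0 \<le> q" "q < 1"
    using p powr_less_mono[of "p - D" 0 2] by (simp_all add: q_def D_def)
  have [measurable]: "(\<lambda>y. norm (b - y) powr (- p)) \<in> borel_measurable (sphere_measure :: 'a measure)"
    by (subst measurable_cong_sets[OF sets_sphere_measure refl], rule measurable_restrict_space1) measurable
  \<comment> \<open>Dyadic decomposition into the caps \<open>E k\<close> of measure \<open>O(2 ^ (- D * k))\<close>.\<close>
  have pw: "ennreal (norm (b - y) powr (- p)) \<le> (\<Sum>k. ennreal (2 powr (p * k)) * indicator (E k) y)"
    if y: "norm y = 1" for y
  \<comment> \<open>At \<open>y = b\<close> the left side is
    \<open>0 powr (- p) = 0\<close>.\<close>
  proof (cases "y = b")
    case False
    define \<rho> where "\<rho> = norm (b - y)"
    have \<rho>: "0 < \<rho>" "\<rho> \<le> 2"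
      using False y b norm_triangle_ineq4[of b y] by (auto simp: \<rho>_def)
    define k where "k = (LEAST k. (1/2) ^ k < \<rho>)"
    obtain k0 where "(1/2) ^ k0 < \<rho>" using real_arch_pow_inv[of \<rho> "1/2"] \<rho> by auto
    then have k: "(1/2) ^ k < \<rho>" unfolding k_def by (rule LeastI)
    have "\<rho> \<le> 2 * (1/2) ^ k"
    proof (cases k)
      case (Suc j)
      then have "\<not> (1/2) ^ j < \<rho>" using not_less_Least[of j "\<lambda>k. (1/2) ^ k < \<rho>"] k_def by simp
      then show ?thesis using Suc by simp
    qed (use \<rho> in simp)
    then have "y \<in> E k" using y by (simp add: E_def \<rho>_def dist_norm)
    have "\<rho> powr (- p) \<le> ((1/2) ^ k) powr (- p)"
      using k \<rho> p by (intro powr_mono2') auto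
    also have "((1/2) ^ k) powr (- p) = 2 powr (p * k)"
      by (simp add: powr_powr powr_minus_divide power_one_over powr_divide mult.commute flip: powr_realpow)
    finally have "ennreal (\<rho> powr (- p)) \<le> ennreal (2 powr (p * k)) * indicator (E k) y"
      using \<open>y \<in> E k\<close> by (simp add: ennreal_leI)
    also have "\<dots> \<le> (\<Sum>k. ennreal (2 powr (p * k)) * indicator (E k) y)"
    proof -
      have "f k \<le> suminf f" for f :: "nat \<Rightarrow> ennreal"
        using sum_le_suminf[of f "{k}"] by simp
      then show ?thesis .
    qed
    finally show ?thesis by (simp add: \<rho>_def)
  qed simp
  have "(\<integral>\<^sup>+y. ennreal (norm (b - y) powr (- p)) \<partial>sphere_measure) \<le>
      (\<integral>\<^sup>+y. (\<Sum>k. ennreal (2 powr (p * k)) * indicator (E k) y) \<partial>sphere_measure)"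
    by (intro nn_integral_mono) (simp add: pw)
  also have "\<dots> = (\<Sum>k. ennreal (2 powr (p * k)) * emeasure sphere_measure (E k))"
    by (simp add: nn_integral_suminf nn_integral_cmult_indicator[OF E_sets])
  also have "\<dots> \<le> (\<Sum>k. ennreal (C * q ^ k))"
  proof (intro suminf_le)
    fix k
    have "ennreal (2 powr (p * k)) * emeasure sphere_measure (E k) \<le>
        ennreal (2 powr (p * k)) * ennreal (2 * (2 * (2 * (1/2) ^ k)) ^ D / unit_ball_vol DIM('a))"
      unfolding E_def D_def by (intro mult_left_mono sphere_measure_cap_le b) auto
    also have "\<dots> = ennreal (2 powr (p * k) * (2 * (2 * (2 * (1/2) ^ k)) ^ D / unit_ball_vol DIM('a)))"
      by (rule ennreal_mult[symmetric]) simp_all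
    also have "2 powr (p * k) * (2 * (2 * (2 * (1/2) ^ k)) ^ D / unit_ball_vol DIM('a)) = C * q ^ k"
    proof -
      have "q ^ k = 2 powr (p * k) * 2 powr (- (D * k))"
        by (simp add: q_def powr_add[symmetric] powr_powr algebra_simps flip: powr_realpow)
      also have "2 powr (- (D * k)) = ((1/2) ^ k) ^ D"
        by (simp add: powr_minus_divide power_one_over powr_powr mult.commute flip: powr_realpow power_mult)
      finally have "q ^ k = 2 powr (p * k) * ((1/2) ^ k) ^ D" .
      moreover have "P * (2 * (2 * (2 * h)) ^ D / V) = 2 * 4 ^ D / V * (P * h ^ D)" for P h V :: real
        by (simp add: power_mult_distrib mult_ac)
      ultimately show ?thesis unfolding C_def by metis
    qed
    finally show "ennreal (2 powr (p * k)) * emeasure sphere_measure (E k) \<le> ennreal (C * q ^ k)" .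
  qed auto
  also have "\<dots> = ennreal (\<Sum>k. C * q ^ k)"
    using q C by (intro suminf_ennreal2 summable_mult summable_geometric) auto
  finally have "(\<integral>\<^sup>+y. ennreal (norm (b - y) powr (- p)) \<partial>sphere_measure) < \<infinity>"
    by (rule le_less_trans) simp
  then show ?thesis by (intro integrableI_nonneg) auto
qed

text \<open>With a basis vector as pole, a constant plus a multiple of an integrable power of the
  distance dominates the profile; rotation then gives every pole.\<close>

lemma integrable_riesz_profile:
  fixes u :: "'a::euclidean_space"
  assumes dim: "DIM('a) \<ge> 2" and s: "s < real (DIM('a) - 1)" and u: "norm u = 1"
  shows "integrable sphere_measure (\<lambda>y. riesz_profile s (u \<bullet> y))"
proof -
  interpret prob_space "sphere_measure :: 'a measure" by (rule prob_space_sphere_measure)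
  obtain b :: 'a where b: "b \<in> Basis" using nonempty_Basis by blast
  \<comment> \<open>A logarithm is dominated by the power 1/2, which is below the dimension of the
    sphere. For \<open>s < 0\<close> the profile is bounded and \<open>p = 0\<close> suffices. In
    \<open>C\<close>, the 2 comes from \<open>- ln \<rho> = 2 * ln (\<rho> powr (- 1/2))\<close>,
    and \<open>2 powr (- s)\<close> from the diameter 2.\<close>
  define p where "p = (if s = 0 then 1/2 else max s 0)"
  define C where "C = max 2 (2 powr (- s))"
  have p: "0 \<le> p" "p < real (DIM('a) - 1)" using s dim by (auto simp: p_def)
  have le: "\<bar>riesz_profile s (b \<bullet> y)\<bar> \<le> C * norm (b - y) powr (- p) + C" if y: "norm y = 1" for y
  proof (cases "y = b")
    case True
    have "b \<bullet> b = 1" using b by simp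
    moreover have "0 \<le> C" by (simp add: C_def le_max_iff_disj)
    ultimately show ?thesis using True by (simp add: riesz_profile_def)
  next
    case False
    define \<rho> where "\<rho> = norm (b - y)"
    have \<rho>: "0 < \<rho>" "\<rho> \<le> 2"
      using False y b norm_triangle_ineq4[of b y] by (auto simp: \<rho>_def)
    have "2 - 2 * (b \<bullet> y) = \<rho>\<^sup>2" using norm_diff_sphere[of b y] b y by (simp add: \<rho>_def)
    then have eq: "riesz_profile s (b \<bullet> y) = (if s = 0 then - ln \<rho> else sgn s * \<rho> powr (- s))"
      using \<rho> by (auto simp: riesz_profile_def ln_realpow powr_powr simp flip: powr_numeral)
    have C: "C \<ge> 2" "C \<ge> 2 powr (- s)" by (auto simp: C_def)
    consider "s = 0" | "s > 0" | "s < 0" by linarith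
    then have "\<bar>riesz_profile s (b \<bullet> y)\<bar> \<le> C * \<rho> powr (- p) + C"
    proof cases
      case 1
      have "ln \<rho> \<le> 2" using ln_bound[of \<rho>] \<rho> by simp
      moreover have "- ln \<rho> = 2 * ln (\<rho> powr (- p))" using 1 \<rho> by (simp add: p_def ln_powr)
      moreover have "ln (\<rho> powr (- p)) \<le> \<rho> powr (- p)" using \<rho> by (intro ln_bound) auto
      moreover have "2 * \<rho> powr (- p) \<le> C * \<rho> powr (- p)" "0 \<le> \<rho> powr (- p)"
        using C by (auto intro: mult_right_mono)
      moreover have "riesz_profile s (b \<bullet> y) = - ln \<rho>" using 1 eq by simp
      ultimately show ?thesis using C by linarith
    next
      case 2
      have "1 * \<rho> powr (- s) \<le> C * \<rho> powr (- s)" using C by (intro mult_right_mono) auto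
      then show ?thesis using 2 C eq by (simp add: p_def abs_mult)
    next
      case 3
      have "\<rho> powr (- s) \<le> 2 powr (- s)" using 3 \<rho> by (intro powr_mono2) auto
      then show ?thesis using 3 C eq by (simp add: p_def abs_mult add_increasing)
    qed
    then show ?thesis by (simp add: \<rho>_def)
  qed
  have "integrable sphere_measure (\<lambda>y. riesz_profile s (b \<bullet> y))"
  proof (rule Bochner_Integration.integrable_bound)
    show "integrable sphere_measure (\<lambda>y. C * norm (b - y) powr (- p) + C)"
      by (intro Bochner_Integration.integrable_add integrable_mult_right
          integrable_norm_powr_sphere b p) simp
    show "AE y in sphere_measure.
        norm (riesz_profile s (b \<bullet> y)) \<le> norm (C * norm (b - y) powr (- p) + C)"
      using order_trans[OF le abs_ge_self] by (intro AE_I2) simp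
  qed measurable
  then show ?thesis
    using b u by (intro sphere_integrable_inner[of u b]) auto
qed

section \<open>Moments\<close>

text \<open>
  Expanding \<open>(u \<bullet> v) ^ n\<close> over words of basis vectors instead of multi-indices keeps all
  coefficients equal to \<open>1\<close>.
\<close>

definition words :: "nat \<Rightarrow> 'a::euclidean_space list set" where
  "words n = {w. set w \<subseteq> Basis \<and> length w = n}"

definition word_monomial :: "'a::euclidean_space list \<Rightarrow> 'a \<Rightarrow> real" where
  "word_monomial w u = (\<Prod>b\<leftarrow>w. u \<bullet> b)"

lemma word_monomial_simps [simp]: "word_monomial [] u = 1" "word_monomial (b # w) u = (u \<bullet> b) * word_monomial w u"
  by (simp_all add: word_monomial_def)

lemma continuous_on_word_monomial [continuous_intros]: "continuous_on A (word_monomial w)"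
proof (induction w)
  case (Cons b w)
  then have "continuous_on A (\<lambda>u. (u \<bullet> b) * word_monomial w u)" by (intro continuous_intros)
  then show ?case by simp
qed (simp add: word_monomial_def)

lemma finite_words [simp]: "finite (words n)"
  unfolding words_def by (rule finite_lists_length_eq) simp

lemma words_Suc: "words (Suc n) = (\<lambda>(b, w). b # w) ` (Basis \<times> words n)"
  by (auto simp: words_def length_Suc_conv image_iff)

text \<open>The power kernel becomes an inner product of vectors of monomials, so double sums and
  double integrals of it turn into sums of squares.\<close>

lemma inner_power_eq_sum_word_monomial:
  fixes u v :: "'a::euclidean_space"
  shows "(u \<bullet> v) ^ n = (\<Sum>w\<in>words n. word_monomial w u * word_monomial w v)"
proof (induction n)
  case 0
  have "(words 0 :: 'a list set) = {[]}" by (auto simp: words_def)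
  then show ?case by simp
next
  case (Suc n)
  have inj: "inj_on (\<lambda>(b, w). b # w) (Basis \<times> words n)" by (auto simp: inj_on_def)
  have "(\<Sum>w\<in>words (Suc n). word_monomial w u * word_monomial w v) =
      (\<Sum>(b, w)\<in>Basis \<times> words n. ((u \<bullet> b) * (v \<bullet> b)) * (word_monomial w u * word_monomial w v))"
    unfolding words_Suc sum.reindex[OF inj] by (intro sum.cong) auto
  also have "\<dots> = (u \<bullet> v) * (\<Sum>w\<in>words n. word_monomial w u * word_monomial w v)"
    by (simp add: euclidean_inner[of u v] sum_product sum.cartesian_product)
  finally show ?case using Suc by simp
qed

section \<open>Moments of the sphere and of finite configurations\<close>

abbreviation mean :: "(nat \<Rightarrow> 'a) \<Rightarrow> nat \<Rightarrow> ('a \<Rightarrow> real) \<Rightarrow> real" where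
  "mean x N f \<equiv> (\<Sum>j=1..N. f (x j)) / real N"

abbreviation sphere_int :: "('a::euclidean_space \<Rightarrow> real) \<Rightarrow> real" where
  "sphere_int f \<equiv> (\<integral>y. f y \<partial>sphere_measure)"

lemma sphere_integrable_continuous:
  fixes f :: "'a::euclidean_space \<Rightarrow> real"
  assumes f: "continuous_on unit_sphere f"
  shows "integrable sphere_measure f"
proof -
  interpret prob_space "sphere_measure :: 'a measure" by (rule prob_space_sphere_measure)
  have "bounded (f ` unit_sphere)"
    by (intro compact_imp_bounded compact_continuous_image f) simp
  then obtain B where "\<And>y. y \<in> unit_sphere \<Longrightarrow> norm (f y) \<le> B"
    unfolding bounded_iff by (metis imageI)
  moreover have "f \<in> borel_measurable sphere_measure"
    using borel_measurable_continuous_on_restrict[OF f]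
    by (simp add: measurable_cong_sets[OF sets_sphere_measure refl])
  ultimately show ?thesis by (intro integrable_const_bound[of _ B] AE_I2) auto
qed

text \<open>The chosen pole is immaterial by rotation invariance, see
  \<open>sphere_moment_eq\<close>.\<close>

definition sphere_moment :: "'a::euclidean_space itself \<Rightarrow> nat \<Rightarrow> real" where
  "sphere_moment _ n = sphere_int (\<lambda>y. ((SOME b::'a. b \<in> Basis) \<bullet> y) ^ n)"

lemma sphere_moment_eq:
  fixes u :: "'a::euclidean_space"
  assumes "norm u = 1"
  shows "sphere_int (\<lambda>y. (u \<bullet> y) ^ n) = sphere_moment TYPE('a) n"
proof -
  have "(SOME b::'a. b \<in> Basis) \<in> Basis"
    by (simp add: some_in_eq)
  then have "norm u = norm (SOME b::'a. b \<in> Basis)"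
    using assms norm_Basis by metis
  moreover have "(\<lambda>t::real. t ^ n) \<in> borel_measurable borel" by measurable
  ultimately show ?thesis unfolding sphere_moment_def by (rule sphere_integral_inner)
qed

lemma sphere_moment_eq_sum:
  fixes u :: "'a::euclidean_space"
  assumes "norm u = 1"
  shows "sphere_moment TYPE('a) n = (\<Sum>w\<in>words n. word_monomial w u * sphere_int (word_monomial w))"
proof -
  have "sphere_moment TYPE('a) n = sphere_int (\<lambda>y. \<Sum>w\<in>words n. word_monomial w u * word_monomial w y)"
    by (simp add: sphere_moment_eq[OF assms, symmetric] inner_power_eq_sum_word_monomial)
  also have "\<dots> = (\<Sum>w\<in>words n. word_monomial w u * sphere_int (word_monomial w))"
    by (subst Bochner_Integration.integral_sum)
       (auto intro!: sphere_integrable_continuous continuous_intros)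
  finally show ?thesis .
qed

text \<open>The expansion in \<open>sphere_moment_eq_sum\<close> has the same value for every
  \<open>u\<close>; averaging it over \<open>u\<close> produces the squares.\<close>

lemma sphere_moment_eq_sum_squares:
  "sphere_moment TYPE('a::euclidean_space) n =
    (\<Sum>w\<in>words n. (sphere_int (word_monomial w :: 'a \<Rightarrow> real))\<^sup>2)"
proof -
  interpret prob_space "sphere_measure :: 'a measure" by (rule prob_space_sphere_measure)
  have "sphere_moment TYPE('a) n = sphere_int (\<lambda>u::'a. sphere_moment TYPE('a) n)"
    using prob_space by simp
  also have "\<dots> = sphere_int (\<lambda>u::'a. \<Sum>w\<in>words n. word_monomial w u * sphere_int (word_monomial w))"
    by (intro Bochner_Integration.integral_cong refl sphere_moment_eq_sum) simp
  also have "\<dots> = (\<Sum>w\<in>words n. (sphere_int (word_monomial w :: 'a \<Rightarrow> real))\<^sup>2)"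
    by (subst Bochner_Integration.integral_sum)
       (auto intro!: sphere_integrable_continuous continuous_intros simp: power2_eq_square)
  finally show ?thesis .
qed

text \<open>The quantity \<open>a\<^sub>n(N)\<close> of the overview.\<close>

definition moment_defect :: "(nat \<Rightarrow> 'a::euclidean_space) \<Rightarrow> nat \<Rightarrow> nat \<Rightarrow> real" where
  "moment_defect x N n = (\<Sum>w\<in>words n. (mean x N (word_monomial w) - sphere_int (word_monomial w))\<^sup>2)"

lemma moment_defect_nonneg: "0 \<le> moment_defect x N n"
  by (simp add: moment_defect_def sum_nonneg)

text \<open>Expand the squared distance of the two moment vectors. Their inner product and the
  squared length of the spherical one both equal \<open>sphere_moment\<close>, so only one copy
  remains to be subtracted from the discrete double mean.\<close>

lemma moment_defect_eq:
  fixes x :: "nat \<Rightarrow> 'a::euclidean_space"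
  assumes x: "\<And>n. n \<ge> 1 \<Longrightarrow> norm (x n) = 1" and N: "N \<ge> 1"
  shows "(\<Sum>i=1..N. \<Sum>j=1..N. (x i \<bullet> x j) ^ n) / (real N)\<^sup>2 =
    sphere_moment TYPE('a) n + moment_defect x N n"
proof -
  have "(\<Sum>i=1..N. \<Sum>j=1..N. (x i \<bullet> x j) ^ n) =
      (\<Sum>i=1..N. \<Sum>w\<in>words n. \<Sum>j=1..N. word_monomial w (x i) * word_monomial w (x j))"
    by (intro sum.cong refl) (subst sum.swap, simp add: inner_power_eq_sum_word_monomial)
  also have "\<dots> = (\<Sum>w\<in>words n. (\<Sum>i=1..N. word_monomial w (x i))\<^sup>2)"
    by (subst sum.swap) (simp add: power2_eq_square sum_product)
  finally have 1: "(\<Sum>i=1..N. \<Sum>j=1..N. (x i \<bullet> x j) ^ n) / (real N)\<^sup>2 =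
      (\<Sum>w\<in>words n. (mean x N (word_monomial w))\<^sup>2)"
    by (simp add: power_divide sum_divide_distrib[of _ _ "(real N)\<^sup>2"])
  \<comment> \<open>The cross term: by rotation invariance every point \<open>x j\<close>
    contributes the same moment.\<close>
  have "real N * sphere_moment TYPE('a) n = (\<Sum>j=1..N. sphere_moment TYPE('a) n)" by simp
  also have "\<dots> = (\<Sum>j=1..N. \<Sum>w\<in>words n. word_monomial w (x j) * sphere_int (word_monomial w))"
    using x by (intro sum.cong refl sphere_moment_eq_sum) auto
  also have "\<dots> = (\<Sum>w\<in>words n. (\<Sum>j=1..N. word_monomial w (x j)) * sphere_int (word_monomial w))"
    by (subst sum.swap) (simp add: sum_distrib_right)
  finally have 2: "sphere_moment TYPE('a) n =
      (\<Sum>w\<in>words n. mean x N (word_monomial w) * sphere_int (word_monomial w))"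
    using N by (simp add: field_simps sum_divide_distrib[symmetric])
  note 3 = sphere_moment_eq_sum_squares[where 'a = 'a, of n]
  have "moment_defect x N n = (\<Sum>w\<in>words n. (mean x N (word_monomial w))\<^sup>2) +
      (\<Sum>w\<in>words n. (sphere_int (word_monomial w :: 'a \<Rightarrow> real))\<^sup>2) -
      2 * (\<Sum>w\<in>words n. mean x N (word_monomial w) * sphere_int (word_monomial w))"
  proof -
    have "(\<Sum>w\<in>W. (p w - q w)\<^sup>2) = (\<Sum>w\<in>W. (p w)\<^sup>2) + (\<Sum>w\<in>W. (q w)\<^sup>2) - 2 * (\<Sum>w\<in>W. p w * q w)"
      for W and p q :: "'a list \<Rightarrow> real"
      by (simp add: power2_diff sum.distrib sum_subtractf sum_distrib_left mult.assoc)
    then show ?thesis unfolding moment_defect_def .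
  qed
  with 1 2 3 show ?thesis by simp
qed

text \<open>A bound independent of \<open>n\<close> and \<open>N\<close>, later used to dominate
  series in \<open>n\<close>.\<close>

lemma moment_defect_le_1:
  fixes x :: "nat \<Rightarrow> 'a::euclidean_space"
  assumes x: "\<And>n. n \<ge> 1 \<Longrightarrow> norm (x n) = 1" and N: "N \<ge> 1"
  shows "moment_defect x N n \<le> 1"
proof -
  have "(x i \<bullet> x j) ^ n \<le> 1" if "i \<ge> 1" "j \<ge> 1" for i j
  proof -
    have "\<bar>x i \<bullet> x j\<bar> ^ n \<le> 1" using that x by (intro power_le_one inner_sphere_bounds) auto
    then show ?thesis by (simp flip: power_abs)
  qed
  then have "(\<Sum>i=1..N. \<Sum>j=1..N. (x i \<bullet> x j) ^ n) \<le> (\<Sum>i=1..N. \<Sum>j=1..N. 1)"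
    by (intro sum_mono) auto
  also have "\<dots> = (real N)\<^sup>2" by (simp add: power2_eq_square)
  finally have "(\<Sum>i=1..N. \<Sum>j=1..N. (x i \<bullet> x j) ^ n) / (real N)\<^sup>2 \<le> 1"
    using N by (simp add: divide_le_eq)
  moreover have "0 \<le> sphere_moment TYPE('a) n"
    by (simp add: sphere_moment_eq_sum_squares sum_nonneg)
  ultimately show ?thesis using moment_defect_eq[of x N n, OF x N] by simp
qed

text \<open>This removes from the energy comparison the coefficient of degree 0, whose sign is not
  controlled.\<close>

lemma moment_defect_0:
  fixes x :: "nat \<Rightarrow> 'a::euclidean_space"
  assumes "N \<ge> 1"
  shows "moment_defect x N 0 = 0"
proof -
  interpret prob_space "sphere_measure :: 'a measure" by (rule prob_space_sphere_measure)
  have "sphere_int (\<lambda>u::'a. 1) = 1" using prob_space by simp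
  moreover have "(words 0 :: 'a list set) = {[]}" by (auto simp: words_def)
  moreover have "word_monomial ([] :: 'a list) = (\<lambda>u. 1)" by (simp add: fun_eq_iff)
  ultimately show ?thesis using assms by (simp add: moment_defect_def)
qed

text \<open>Cauchy-Schwarz against the vector of monomials at \<open>u\<close>, whose squared length
  is \<open>(u \<bullet> u) ^ n = 1\<close>; hence the bound does not depend on
  \<open>u\<close>.\<close>

lemma mean_inner_power_le:
  fixes x :: "nat \<Rightarrow> 'a::euclidean_space"
  assumes u: "norm u = 1"
  shows "\<bar>mean x N (\<lambda>v. (u \<bullet> v) ^ n) - sphere_moment TYPE('a) n\<bar> \<le> sqrt (moment_defect x N n)"
proof -
  have "mean x N (\<lambda>v. (u \<bullet> v) ^ n) = (\<Sum>w\<in>words n. word_monomial w u * mean x N (word_monomial w))"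
    unfolding inner_power_eq_sum_word_monomial
    by (subst sum.swap) (simp add: sum_distrib_left sum_divide_distrib)
  then have "mean x N (\<lambda>v. (u \<bullet> v) ^ n) - sphere_moment TYPE('a) n =
      (\<Sum>w\<in>words n. word_monomial w u * (mean x N (word_monomial w) - sphere_int (word_monomial w)))"
    by (simp add: sphere_moment_eq_sum[OF u] right_diff_distrib sum_subtractf)
  then have "(mean x N (\<lambda>v. (u \<bullet> v) ^ n) - sphere_moment TYPE('a) n)\<^sup>2 \<le>
      (\<Sum>w\<in>words n. (word_monomial w u)\<^sup>2) * moment_defect x N n"
    unfolding moment_defect_def by (simp only: Cauchy_Schwarz_ineq_sum)
  also have "(\<Sum>w\<in>words n. (word_monomial w u)\<^sup>2) = 1"
    using inner_power_eq_sum_word_monomial[of u u n] u by (simp add: power2_eq_square dot_square_norm)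
  finally show ?thesis by (intro real_le_rsqrt) (simp add: power2_abs)
qed

text \<open>Convergence passes from monomials to polynomials by linearity, and to continuous
  functions by uniform approximation with three errors of size \<open>e / 3\<close>.\<close>

lemma uniformly_distributedI:
  fixes x :: "nat \<Rightarrow> 'a::euclidean_space"
  assumes x: "\<And>n. n \<ge> 1 \<Longrightarrow> norm (x n) = 1"
    and lim: "\<And>w. set w \<subseteq> Basis \<Longrightarrow> (\<lambda>N. mean x N (word_monomial w)) \<longlonglongrightarrow> sphere_int (word_monomial w)"
  shows "uniformly_distributed x"
proof -
  interpret prob_space "sphere_measure :: 'a measure" by (rule prob_space_sphere_measure)
  define conv where "conv f \<longleftrightarrow> continuous_on unit_sphere f \<and>
    (\<lambda>N. mean x N f) \<longlonglongrightarrow> sphere_int f" for f :: "'a \<Rightarrow> real"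
  have conv_add: "conv (\<lambda>u. f u + g u)" if "conv f" "conv g" for f g
    using that by (auto simp: conv_def sum.distrib add_divide_distrib
        sphere_integrable_continuous intro!: continuous_intros tendsto_intros)
  have conv_cmult: "conv (\<lambda>u. c * f u)" if "conv f" for c f
  proof -
    have "(\<lambda>N. c * mean x N f) \<longlonglongrightarrow> c * sphere_int f"
      using that by (intro tendsto_intros) (simp add: conv_def)
    then show ?thesis using that by (auto simp: conv_def sum_distrib_left intro!: continuous_intros)
  qed
  have conv_sum: "conv (\<lambda>u. \<Sum>b\<in>A. c b * f b u)"
    if "finite A" "\<And>b. b \<in> A \<Longrightarrow> conv (f b)" for A :: "'a set" and c f
    using that
  proof (induction A rule: finite_induct)
    case empty
    show ?case by (simp add: conv_def)
  qed (simp add: conv_add conv_cmult)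
  \<comment> \<open>Quantifying over a cofactor \<open>f\<close> in \<open>good_mult\<close> makes the product case of the induction go through.\<close>
  define good where "good f \<longleftrightarrow> (\<forall>w. set w \<subseteq> Basis \<longrightarrow> conv (\<lambda>u. word_monomial w u * f u))"
    for f :: "'a \<Rightarrow> real"
  have good_mult: "good (\<lambda>u. f u * p u)" if "real_polynomial_function p" "good f" for f p
    using that
  proof (induction p arbitrary: f rule: real_polynomial_function.induct)
    case (linear h)
    show ?case unfolding good_def
    proof (intro allI impI)
      fix w :: "'a list" assume w: "set w \<subseteq> Basis"
      \<comment> \<open>A linear functional is a combination of coordinates, and multiplying by a
        coordinate prepends a letter to the word.\<close>
      have h_eq: "h u = (\<Sum>b\<in>Basis. (u \<bullet> b) * h b)" for u
        using linear(1) by (subst euclidean_representation[of u, symmetric])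
          (simp add: bounded_linear.linear linear_sum linear_scale)
      have "(\<lambda>u. word_monomial w u * (f u * h u)) =
          (\<lambda>u. \<Sum>b\<in>Basis. h b * (word_monomial (b # w) u * f u))"
        by (rule ext, subst h_eq) (simp add: sum_distrib_left mult_ac)
      moreover have "conv (\<lambda>u. word_monomial (b # w) u * f u)" if "b \<in> Basis" for b
        using linear(2) w that unfolding good_def by (metis insert_subset list.simps(15))
      ultimately show "conv (\<lambda>u. word_monomial w u * (f u * h u))"
        using conv_sum[of Basis "\<lambda>b u. word_monomial (b # w) u * f u" h] by simp
    qed
  next
    case (const c)
    then show ?case using conv_cmult[of _ c] by (auto simp: good_def mult_ac)
  next
    case (add p q)
    from add(3)[OF add(5)] add(4)[OF add(5)] show ?case
      using conv_add by (auto simp: good_def distrib_left)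
  next
    case (mult p q)
    from mult(4)[OF mult(3)[OF mult(5)]] show ?case by (simp add: mult.assoc)
  qed
  \<comment> \<open>Start from the cofactor 1; the empty word then recovers \<open>p\<close>
    itself.\<close>
  have "good (\<lambda>u. 1)"
    using lim by (auto simp: good_def conv_def intro: continuous_intros)
  then have poly: "conv p" if "real_polynomial_function p" for p
    using good_mult[OF that, of "\<lambda>u. 1"] unfolding good_def by (auto dest: spec[of _ "[]"])
  have "(\<lambda>N. mean x N f) \<longlonglongrightarrow> sphere_int f" if f: "continuous_on unit_sphere f" for f :: "'a \<Rightarrow> real"
  proof (rule LIMSEQ_I)
    fix e :: real assume e: "0 < e"
    obtain p where p: "real_polynomial_function p" "\<And>u. u \<in> unit_sphere \<Longrightarrow> \<bar>f u - p u\<bar> < e / 3"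
      using Stone_Weierstrass_real_polynomial_function[of unit_sphere f "e / 3"] f e by auto
    have cp: "continuous_on unit_sphere p" "(\<lambda>N. mean x N p) \<longlonglongrightarrow> sphere_int p"
      using poly[OF p(1)] by (simp_all add: conv_def)
    have "\<bar>sphere_int f - sphere_int p\<bar> = \<bar>sphere_int (\<lambda>u. f u - p u)\<bar>"
      using f cp by (simp add: sphere_integrable_continuous)
    also have "\<dots> \<le> sphere_int (\<lambda>u. \<bar>f u - p u\<bar>)" by (rule integral_abs_bound)
    also have "\<dots> \<le> sphere_int (\<lambda>u::'a. e / 3)"
      using p(2) f cp by (intro Bochner_Integration.integral_mono sphere_integrable_continuous continuous_intros)
        (auto intro: less_imp_le)
    also have "\<dots> = e / 3" using prob_space by simp
    finally have 1: "\<bar>sphere_int f - sphere_int p\<bar> \<le> e / 3" .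
    have 2: "\<bar>mean x N f - mean x N p\<bar> \<le> e / 3" for N
    proof (cases "N = 0")
      case False
      have "\<bar>\<Sum>j=1..N. f (x j) - p (x j)\<bar> \<le> (\<Sum>j=1..N. e / 3)"
        using p(2) x by (intro order_trans[OF sum_abs] sum_mono) (auto intro: less_imp_le)
      then show ?thesis using False
        by (simp add: sum_subtractf diff_divide_distrib[symmetric] field_simps)
    qed (use e in simp)
    obtain M where M: "\<And>N. N \<ge> M \<Longrightarrow> \<bar>mean x N p - sphere_int p\<bar> < e / 3"
      using LIMSEQ_D[OF cp(2), of "e / 3"] e by auto
    have "\<bar>mean x N f - sphere_int f\<bar> < e" if "N \<ge> M" for N
      using M[OF that] 1 2[of N] by linarith
    then show "\<exists>M. \<forall>N\<ge>M. norm (mean x N f - sphere_int f) < e" by auto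
  qed
  then show ?thesis
    using x by (simp add: uniformly_distributed_def weak_star_conv_sphere_def integral_empirical_measure)
qed

section \<open>Energy of greedy sequences\<close>

lemma riesz_energy_eq:
  fixes u :: "'a::euclidean_space"
  assumes u: "norm u = 1"
  shows "riesz_energy TYPE('a) s = sphere_int (\<lambda>y. riesz_profile s (u \<bullet> y))"
proof -
  interpret prob_space "sphere_measure :: 'a measure" by (rule prob_space_sphere_measure)
  have "sphere_int (\<lambda>y. real_of_ereal (riesz_kernel s v y)) = sphere_int (\<lambda>y. riesz_profile s (u \<bullet> y))"
    if v: "norm v = 1" for v :: 'a
  proof -
    have "sphere_int (\<lambda>y. real_of_ereal (riesz_kernel s v y)) = sphere_int (\<lambda>y. riesz_profile s (v \<bullet> y))"
      using v by (intro Bochner_Integration.integral_cong refl) (simp add: real_of_ereal_riesz_kernel)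
    also have "\<dots> = sphere_int (\<lambda>y. riesz_profile s (u \<bullet> y))"
      using u v by (intro sphere_integral_inner) auto
    finally show ?thesis .
  qed
  then have "riesz_energy TYPE('a) s =
      sphere_int (\<lambda>v::'a. sphere_int (\<lambda>y. riesz_profile s (u \<bullet> y)))"
    unfolding riesz_energy_def by (rule Bochner_Integration.integral_cong[OF refl]) simp
  then show ?thesis using prob_space by simp
qed

text \<open>The minimum is at most the average, and each point contributes the energy to the average
  of the potential. Infinite values occur only at the points \<open>x j\<close>, a null set.\<close>

lemma polarization_le_energy:
  fixes x :: "nat \<Rightarrow> 'a::euclidean_space"
  assumes dim: "DIM('a) \<ge> 2" and s: "s < real (DIM('a) - 1)"
    and x: "\<And>n. n \<ge> 1 \<Longrightarrow> norm (x n) = 1"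
  shows "polarization (riesz_kernel s) x N \<le> ereal (real N * riesz_energy TYPE('a) s)"
proof -
  interpret prob_space "sphere_measure :: 'a measure" by (rule prob_space_sphere_measure)
  define h where "h y = (\<Sum>j=1..N. riesz_profile s (x j \<bullet> y))" for y
  have int: "integrable sphere_measure (\<lambda>y. riesz_profile s (x j \<bullet> y))" if "j \<in> {1..N}" for j
    using that x by (intro integrable_riesz_profile dim s) auto
  have h: "integrable sphere_measure h"
    unfolding h_def by (intro Bochner_Integration.integrable_sum int)
  have h_int: "sphere_int h = real N * riesz_energy TYPE('a) s"
    unfolding h_def using x
    by (subst Bochner_Integration.integral_sum) (auto intro: int simp: riesz_energy_eq[symmetric])
  have "AE y in sphere_measure. \<forall>j\<in>{1..N}. y \<noteq> x j"
    using x by (intro AE_finite_allI AE_sphere_measure_neq dim) auto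
  moreover have "AE y in sphere_measure. y \<in> (unit_sphere :: 'a set)"
    by (intro AE_I2) simp
  ultimately have le: "AE y in sphere_measure. polarization (riesz_kernel s) x N \<le> ereal (h y)"
  proof eventually_elim
    case (elim y)
    have "polarization (riesz_kernel s) x N \<le> potential (riesz_kernel s) x N y"
      unfolding polarization_def using elim by (intro INF_lower)
    also have "\<dots> = (\<Sum>j=1..N. ereal (riesz_profile s (x j \<bullet> y)))"
      unfolding potential_def using elim x
      by (intro sum.cong refl) (simp add: riesz_kernel_sphere inner_commute)
    finally show ?case by (simp add: h_def)
  qed
  show ?thesis
  \<comment> \<open>A finite value can be integrated; the value \<open>\<infinity>\<close> would
    contradict the real bound \<open>h\<close>.\<close>
  proof (cases "polarization (riesz_kernel s) x N")
    case (real p)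
    have "sphere_int (\<lambda>y::'a. p) \<le> sphere_int h"
      using le real h by (intro integral_mono_AE) auto
    then show ?thesis using real h_int prob_space by simp
  next
    case PInf
    with le have "AE y in (sphere_measure :: 'a measure). False" by simp
    then show ?thesis by simp
  qed simp
qed

lemma greedy_potential_le_polarization:
  assumes "greedy_sequence K m x" "N \<ge> m"
  shows "potential K x N (x (Suc N)) \<le> polarization K x N"
  using assms unfolding greedy_sequence_def polarization_def is_arg_min_def
  by (intro INF_greatest) (metis linorder_not_less)

lemma potential_ge:
  fixes x :: "nat \<Rightarrow> 'a::euclidean_space"
  assumes K: "\<And>u v::'a. norm u = 1 \<Longrightarrow> norm v = 1 \<Longrightarrow> ereal (k (u \<bullet> v)) \<le> K u v"
    and x: "\<And>n. n \<ge> 1 \<Longrightarrow> norm (x n) = 1" and u: "norm u = 1"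
  shows "ereal (\<Sum>j=1..N. k (u \<bullet> x j)) \<le> potential K x N u"
proof -
  have "(\<Sum>j=1..N. ereal (k (u \<bullet> x j))) \<le> (\<Sum>j=1..N. K u (x j))"
    using K x u by (intro sum_mono) auto
  then show ?thesis by (simp add: potential_def)
qed

text \<open>The point added to \<open>N\<close> others raises the double sum by twice its potential,
  at most \<open>2 * N * (I + \<epsilon>)\<close>, plus the self-interaction \<open>k 1\<close>. As
  \<open>k\<close> is real-valued, the diagonal costs only a linear term.\<close>

lemma greedy_discrete_energy_le:
  fixes x :: "nat \<Rightarrow> 'a::euclidean_space"
  assumes dim: "DIM('a) \<ge> 2" and s: "s < real (DIM('a) - 1)"
    and g: "greedy_sequence (riesz_kernel s) m x"
    and k: "\<And>u v::'a. norm u = 1 \<Longrightarrow> norm v = 1 \<Longrightarrow> ereal (k (u \<bullet> v) - \<epsilon>) \<le> riesz_kernel s u v"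
  shows "\<exists>A B. \<forall>N\<ge>m. (\<Sum>i=1..N. \<Sum>j=1..N. k (x i \<bullet> x j)) \<le>
    (riesz_energy TYPE('a) s + \<epsilon>) * (real N)\<^sup>2 + A + B * real N"
proof -
  have x: "norm (x n) = 1" if "n \<ge> 1" for n
    using g that by (auto simp: greedy_sequence_def)
  define I where "I = riesz_energy TYPE('a) s"
  define G where "G N = (\<Sum>i=1..N. \<Sum>j=1..N. k (x i \<bullet> x j))" for N
  \<comment> \<open>Chosen so that \<open>H\<close> is nonincreasing from \<open>m\<close> on: it
    absorbs \<open>k 1\<close> and the remainder \<open>I + \<epsilon>\<close> of the increment of
    \<open>(I + \<epsilon>) * (real N)\<^sup>2\<close>. The initial points enter through
    \<open>H m\<close>.\<close>
  define B where "B = k 1 - (I + \<epsilon>)"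
  define H where "H N = G N - (I + \<epsilon>) * (real N)\<^sup>2 - B * real N" for N
  have "H (Suc N) \<le> H N" if N: "N \<ge> m" for N
  proof -
    have "ereal (\<Sum>j=1..N. k (x (Suc N) \<bullet> x j) - \<epsilon>) \<le> potential (riesz_kernel s) x N (x (Suc N))"
      by (rule potential_ge[where k = "\<lambda>t. k t - \<epsilon>"]) (use k x in auto)
    also have "\<dots> \<le> polarization (riesz_kernel s) x N"
      by (rule greedy_potential_le_polarization[OF g N])
    also have "\<dots> \<le> ereal (real N * I)"
      unfolding I_def by (rule polarization_le_energy[OF dim s]) (rule x)
    finally have "(\<Sum>j=1..N. k (x (Suc N) \<bullet> x j)) \<le> real N * (I + \<epsilon>)"
      by (simp add: sum_subtractf algebra_simps)
    moreover have "G (Suc N) = G N + 2 * (\<Sum>j=1..N. k (x (Suc N) \<bullet> x j)) + k 1"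
      using x[of "Suc N"] by (simp add: G_def sum.distrib inner_commute dot_square_norm)
    ultimately show ?thesis
      by (simp add: H_def B_def power2_eq_square algebra_simps)
  qed
  note step = this
  have "H N \<le> H m" if "N \<ge> m" for N
    using that by (induction rule: dec_induct) (auto intro: order_trans[OF step])
  then have "\<forall>N\<ge>m. G N \<le> (I + \<epsilon>) * (real N)\<^sup>2 + H m + B * real N"
    by (simp add: H_def algebra_simps)
  then show ?thesis unfolding G_def I_def by blast
qed

section \<open>Power series for the energy of the dilated kernel\<close>

lemma summable_riesz_coeff:
  assumes "\<bar>r\<bar> < 1"
  shows "summable (\<lambda>n. \<bar>riesz_coeff s n\<bar> * \<bar>r\<bar> ^ n)"
proof -
  \<comment> \<open>Convergence at a radius strictly between \<open>\<bar>r\<bar>\<close> and 1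
    yields absolute convergence at \<open>r\<close>.\<close>
  have "summable (\<lambda>n. riesz_coeff s n * ((1 + \<bar>r\<bar>) / 2) ^ n)"
    using assms by (intro sums_summable[OF riesz_profile_sums]) auto
  then have "summable (\<lambda>n. norm (riesz_coeff s n * r ^ n))"
    using assms by (intro powser_insidea) auto
  then show ?thesis by (simp add: abs_mult power_abs)
qed

definition dilated_energy :: "'a::euclidean_space itself \<Rightarrow> real \<Rightarrow> real \<Rightarrow> real" where
  "dilated_energy _ s r = (\<Sum>n. riesz_coeff s n * r ^ n * sphere_moment TYPE('a) n)"

text \<open>The power series may be integrated term by term because the absolutely summable bounds
  are uniform on the sphere.\<close>

lemma dilated_energy:
  fixes u :: "'a::euclidean_space"
  assumes r: "0 \<le> r" "r < 1" and u: "norm u = 1"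
  shows "dilated_energy TYPE('a) s r = sphere_int (\<lambda>y. riesz_profile s (r * (u \<bullet> y)))"
    and "(\<lambda>n. riesz_coeff s n * r ^ n * sphere_moment TYPE('a) n) sums dilated_energy TYPE('a) s r"
proof -
  interpret prob_space "sphere_measure :: 'a measure" by (rule prob_space_sphere_measure)
  define f where "f n y = riesz_coeff s n * r ^ n * (u \<bullet> y) ^ n" for n y
  have le: "norm (f n y) \<le> \<bar>riesz_coeff s n\<bar> * \<bar>r\<bar> ^ n" if "norm y = 1" for n y
  proof -
    have "\<bar>u \<bullet> y\<bar> ^ n \<le> 1" using that u by (intro power_le_one inner_sphere_bounds) auto
    then show ?thesis
      using mult_left_mono[of "\<bar>u \<bullet> y\<bar> ^ n" 1 "\<bar>riesz_coeff s n\<bar> * \<bar>r\<bar> ^ n"]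
      by (simp add: f_def abs_mult power_abs)
  qed
  have S: "summable (\<lambda>n. \<bar>riesz_coeff s n\<bar> * \<bar>r\<bar> ^ n)"
    using r by (intro summable_riesz_coeff) auto
  have int: "integrable sphere_measure (f n)" for n
    unfolding f_def by (intro sphere_integrable_continuous continuous_intros)
  have *: "(\<lambda>n. sphere_int (f n)) sums sphere_int (\<lambda>y. \<Sum>n. f n y)"
  proof (rule sums_integral)
    show "AE y in sphere_measure. summable (\<lambda>n. norm (f n y))"
      using le by (intro AE_I2 summable_comparison_test'[OF S, of 0]) simp
    have "sphere_int (\<lambda>y. norm (f n y)) \<le> sphere_int (\<lambda>y::'a. \<bar>riesz_coeff s n\<bar> * \<bar>r\<bar> ^ n)" for n
      by (intro Bochner_Integration.integral_mono integrable_norm int) (auto intro: le simp del: real_norm_def)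
    then have "norm (sphere_int (\<lambda>y. norm (f n y))) \<le> \<bar>riesz_coeff s n\<bar> * \<bar>r\<bar> ^ n" for n
      using prob_space by simp
    then show "summable (\<lambda>n. sphere_int (\<lambda>y. norm (f n y)))"
      by (intro summable_comparison_test'[OF S, of 0])
  qed (rule int)
  have "sphere_int (f n) = riesz_coeff s n * r ^ n * sphere_moment TYPE('a) n" for n
    by (simp add: f_def sphere_moment_eq[OF u])
  moreover have "sphere_int (\<lambda>y. \<Sum>n. f n y) = sphere_int (\<lambda>y. riesz_profile s (r * (u \<bullet> y)))"
  proof (intro Bochner_Integration.integral_cong refl)
    fix y :: 'a assume "y \<in> space sphere_measure"
    then have "\<bar>u \<bullet> y\<bar> \<le> 1" using u by (intro inner_sphere_bounds) auto
    then have "\<bar>r * (u \<bullet> y)\<bar> < 1"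
      using r mult_left_mono[of "\<bar>u \<bullet> y\<bar>" 1 r] by (simp add: abs_mult)
    from riesz_profile_sums[OF this, of s]
    show "(\<Sum>n. f n y) = riesz_profile s (r * (u \<bullet> y))"
      by (simp add: f_def sums_iff power_mult_distrib mult.assoc)
  qed
  ultimately have "(\<lambda>n. riesz_coeff s n * r ^ n * sphere_moment TYPE('a) n) sums
      sphere_int (\<lambda>y. riesz_profile s (r * (u \<bullet> y)))"
    using * by simp
  then show "dilated_energy TYPE('a) s r = sphere_int (\<lambda>y. riesz_profile s (r * (u \<bullet> y)))"
    "(\<lambda>n. riesz_coeff s n * r ^ n * sphere_moment TYPE('a) n) sums dilated_energy TYPE('a) s r"
    by (simp_all add: dilated_energy_def sums_iff)
qed

lemma dilated_energy_tendsto: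
  assumes dim: "DIM('a::euclidean_space) \<ge> 2" and s: "s < real (DIM('a) - 1)"
    and r: "\<And>k::nat. 0 \<le> r k \<and> r k < 1" "r \<longlonglongrightarrow> 1"
  shows "(\<lambda>k. dilated_energy TYPE('a) s (r k)) \<longlonglongrightarrow> riesz_energy TYPE('a) s"
proof -
  interpret prob_space "sphere_measure :: 'a measure" by (rule prob_space_sphere_measure)
  obtain u :: 'a where u: "norm u = 1" using nonempty_Basis norm_Basis by blast
  \<comment> \<open>By monotonicity, \<open>riesz_profile s (r k * t)\<close> lies between the
    values at 0 and \<open>t\<close> for \<open>t \<ge> 0\<close>, and between those at
    \<open>- 1\<close> and 0 for \<open>t < 0\<close>. This gives an integrable majorant independent
    of \<open>k\<close>.\<close>
  define C where "C = \<bar>riesz_profile s 0\<bar> + \<bar>riesz_profile s (- 1)\<bar>"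
  have int: "integrable sphere_measure (\<lambda>y. riesz_profile s (u \<bullet> y))"
    by (rule integrable_riesz_profile[OF dim s u])
  have AE1: "AE y in sphere_measure. - 1 \<le> u \<bullet> y \<and> u \<bullet> y < 1"
    using AE_sphere_measure_neq[OF u dim] AE_space
  proof eventually_elim
    case (elim y)
    then show ?case
      using inner_sphere_bounds[of u y] inner_sphere_eq_1_iff[of u y] u by force
  qed
  have "(\<lambda>k. sphere_int (\<lambda>y. riesz_profile s (r k * (u \<bullet> y)))) \<longlonglongrightarrow>
      sphere_int (\<lambda>y. riesz_profile s (u \<bullet> y))"
  proof (rule integral_dominated_convergence[where w = "\<lambda>y. \<bar>riesz_profile s (u \<bullet> y)\<bar> + C"])
    show "integrable sphere_measure (\<lambda>y. \<bar>riesz_profile s (u \<bullet> y)\<bar> + C)"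
      by (intro Bochner_Integration.integrable_add integrable_abs int) simp
    show "AE y in sphere_measure. (\<lambda>k. riesz_profile s (r k * (u \<bullet> y))) \<longlonglongrightarrow> riesz_profile s (u \<bullet> y)"
      using AE1
    proof eventually_elim
      case (elim y)
      have "(\<lambda>k. r k * (u \<bullet> y)) \<longlonglongrightarrow> 1 * (u \<bullet> y)" by (intro tendsto_intros r)
      moreover have "isCont (riesz_profile s) (u \<bullet> y)"
        using continuous_on_riesz_profile elim by (simp add: continuous_on_eq_continuous_at)
      ultimately show ?case by (auto intro: isCont_tendsto_compose)
    qed
    show "AE y in sphere_measure. norm (riesz_profile s (r k * (u \<bullet> y))) \<le> \<bar>riesz_profile s (u \<bullet> y)\<bar> + C" for k
      using AE1
    proof eventually_elim
      case (elim y)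
      show ?case
      proof (cases "u \<bullet> y \<ge> 0")
        case True
        have "r k * (u \<bullet> y) \<le> u \<bullet> y" "0 \<le> r k * (u \<bullet> y)"
          using True r(1)[of k] by (auto intro: mult_left_le_one_le)
        then have "riesz_profile s 0 \<le> riesz_profile s (r k * (u \<bullet> y))"
            "riesz_profile s (r k * (u \<bullet> y)) \<le> riesz_profile s (u \<bullet> y)"
          using elim by (auto intro!: riesz_profile_mono)
        then show ?thesis by (simp add: C_def)
      next
        case False
        have "r k * (u \<bullet> y) \<le> 0" "- 1 \<le> r k * (u \<bullet> y)"
          using False r(1)[of k] elim mult_mono[of "r k" 1 "- (u \<bullet> y)" 1]
          by (auto simp: mult_nonneg_nonpos)
        then have "riesz_profile s (- 1) \<le> riesz_profile s (r k * (u \<bullet> y))"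
            "riesz_profile s (r k * (u \<bullet> y)) \<le> riesz_profile s 0"
          by (auto intro!: riesz_profile_mono)
        then show ?thesis by (simp add: C_def)
      qed
    qed
  qed measurable
  then show ?thesis
    using r by (simp add: riesz_energy_eq[OF u] dilated_energy(1)[OF _ _ u])
qed

lemma obtain_dilation:
  assumes dim: "DIM('a::euclidean_space) \<ge> 2" and s: "- 2 < s" "s < real (DIM('a) - 1)"
    and \<epsilon>: "\<epsilon> > 0"
  obtains r where "1/2 \<le> r" "r < 1"
    "\<And>u v::'a. norm u = 1 \<Longrightarrow> norm v = 1 \<Longrightarrow>
      ereal (riesz_profile s (r * (u \<bullet> v)) - \<epsilon>) \<le> riesz_kernel s u v"
    "riesz_energy TYPE('a) s - \<epsilon> < dilated_energy TYPE('a) s r"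
proof -
  \<comment> \<open>This sequence stays above 1/2, so \<open>r ^ n\<close> has a lower bound that
    does not depend on \<open>\<epsilon>\<close>.\<close>
  define r where "r k = 1 - 1 / (real k + 2)" for k
  have r: "0 \<le> r k \<and> r k < 1" "1/2 \<le> r k" for k by (auto simp: r_def field_simps)
  have r1: "r \<longlonglongrightarrow> 1" unfolding r_def[abs_def] by real_asymp
  have "filterlim r (at_left 1) sequentially"
    unfolding filterlim_at using r r1 by (auto intro!: always_eventually simp: less_imp_neq)
  note ev = filterlim_iff[THEN iffD1, OF this, rule_format,
      OF riesz_kernel_dilation_le[OF \<epsilon> s(1), where 'a = 'a]]
  have "\<forall>\<^sub>F k in sequentially. riesz_energy TYPE('a) s - \<epsilon> < dilated_energy TYPE('a) s (r k)"
    using order_tendstoD(1)[OF dilated_energy_tendsto[OF dim s(2) r(1) r1]] \<epsilon> by simp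
  with ev obtain k where "\<And>u v::'a. norm u = 1 \<Longrightarrow> norm v = 1 \<Longrightarrow>
        ereal (riesz_profile s (r k * (u \<bullet> v)) - \<epsilon>) \<le> riesz_kernel s u v"
      "riesz_energy TYPE('a) s - \<epsilon> < dilated_energy TYPE('a) s (r k)"
    using eventually_happens'[OF sequentially_bot eventually_conj] by blast
  with r[of k] show ?thesis by (intro that[of "r k"]) auto
qed

lemma discrete_dilated_energy_sums:
  fixes x :: "nat \<Rightarrow> 'a::euclidean_space"
  assumes r: "0 \<le> r" "r < 1" and x: "\<And>n. n \<ge> 1 \<Longrightarrow> norm (x n) = 1" and N: "N \<ge> 1"
  shows "(\<lambda>n. riesz_coeff s n * r ^ n * (sphere_moment TYPE('a) n + moment_defect x N n)) sums
    ((\<Sum>i=1..N. \<Sum>j=1..N. riesz_profile s (r * (x i \<bullet> x j))) / (real N)\<^sup>2)"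
proof -
  have "(\<lambda>n. (\<Sum>i=1..N. \<Sum>j=1..N. riesz_coeff s n * (r * (x i \<bullet> x j)) ^ n) / (real N)\<^sup>2) sums
    ((\<Sum>i=1..N. \<Sum>j=1..N. riesz_profile s (r * (x i \<bullet> x j))) / (real N)\<^sup>2)"
  proof (intro sums_divide sums_sum riesz_profile_sums)
    fix i j assume "i \<in> {1..N}" "j \<in> {1..N}"
    then have "\<bar>x i \<bullet> x j\<bar> \<le> 1" using x by (intro inner_sphere_bounds) auto
    then show "\<bar>r * (x i \<bullet> x j)\<bar> < 1"
      using r mult_left_mono[of "\<bar>x i \<bullet> x j\<bar>" 1 r] by (simp add: abs_mult)
  qed
  moreover have "(\<Sum>i=1..N. \<Sum>j=1..N. riesz_coeff s n * (r * (x i \<bullet> x j)) ^ n) / (real N)\<^sup>2 =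
      riesz_coeff s n * r ^ n * (sphere_moment TYPE('a) n + moment_defect x N n)" for n
  proof -
    have "sphere_moment TYPE('a) n + moment_defect x N n =
        (\<Sum>i=1..N. \<Sum>j=1..N. (x i \<bullet> x j) ^ n) / (real N)\<^sup>2"
      using x N by (intro moment_defect_eq[symmetric])
    then show ?thesis by (simp add: power_mult_distrib sum_distrib_left mult.assoc)
  qed
  ultimately show ?thesis by simp
qed

text \<open>The gap is the sum of all such terms. They are nonnegative, that of degree 0 being zero,
  so each is at most the sum.\<close>

lemma moment_defect_le_energy_gap:
  fixes x :: "nat \<Rightarrow> 'a::euclidean_space"
  assumes s: "- 2 < s" and r: "0 \<le> r" "r < 1"
    and x: "\<And>n. n \<ge> 1 \<Longrightarrow> norm (x n) = 1" and N: "N \<ge> 1" and n: "n \<ge> 1"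
  shows "riesz_coeff s n * r ^ n * moment_defect x N n \<le>
    (\<Sum>i=1..N. \<Sum>j=1..N. riesz_profile s (r * (x i \<bullet> x j))) / (real N)\<^sup>2 - dilated_energy TYPE('a) s r"
proof -
  obtain u :: 'a where u: "norm u = 1" using nonempty_Basis norm_Basis by blast
  have sm: "(\<lambda>n. riesz_coeff s n * r ^ n * moment_defect x N n) sums
      ((\<Sum>i=1..N. \<Sum>j=1..N. riesz_profile s (r * (x i \<bullet> x j))) / (real N)\<^sup>2 - dilated_energy TYPE('a) s r)"
    using sums_diff[OF discrete_dilated_energy_sums[of r x N s] dilated_energy(2)[OF r u, of s]] r x N
    by (simp add: distrib_left)
  have "0 \<le> riesz_coeff s k * r ^ k * moment_defect x N k" for k
    using riesz_coeff_pos[OF s, of k] r N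
    by (cases "k = 0") (auto simp: moment_defect_0 moment_defect_nonneg)
  then have "(\<Sum>k\<in>{n}. riesz_coeff s k * r ^ k * moment_defect x N k) \<le>
      (\<Sum>k. riesz_coeff s k * r ^ k * moment_defect x N k)"
    using sm by (intro sum_le_suminf) (auto simp: sums_iff)
  then show ?thesis using sm by (simp add: sums_iff)
qed

lemma moment_defect_tendsto_0:
  fixes x :: "nat \<Rightarrow> 'a::euclidean_space"
  assumes dim: "DIM('a) \<ge> 2" and s: "- 2 < s" "s < real (DIM('a) - 1)"
    and g: "greedy_sequence (riesz_kernel s) m x"
  shows "(\<lambda>N. moment_defect x N n) \<longlonglongrightarrow> 0"
proof (cases "n = 0")
  case True
  have "\<forall>\<^sub>F N in sequentially. moment_defect x N n = 0"
    using eventually_ge_at_top[of 1] by eventually_elim (simp add: moment_defect_0 True)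
  then show ?thesis by (rule tendsto_eventually)
next
  case False
  have x: "norm (x n) = 1" if "n \<ge> 1" for n
    using g that by (auto simp: greedy_sequence_def)
  define I where "I = riesz_energy TYPE('a) s"
  \<comment> \<open>1/2 stands in for \<open>r\<close>, which is chosen only after
    \<open>\<epsilon>\<close> and hence depends on \<open>c\<close>.\<close>
  define c where "c = riesz_coeff s n * (1/2) ^ n"
  have c: "c > 0" using False riesz_coeff_pos[OF s(1), of n] by (simp add: c_def)
  show ?thesis
  proof (rule LIMSEQ_I)
    fix \<delta> :: real assume \<delta>: "\<delta> > 0"
    \<comment> \<open>The gap is below \<open>3 * \<epsilon>\<close>: one part each from the kernel
      comparison, the dilated energy and the lower-order terms. Division by 4 makes this less than
      \<open>c * \<delta>\<close>.\<close>
    define \<epsilon> where "\<epsilon> = \<delta> * c / 4"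
    have \<epsilon>: "\<epsilon> > 0" using \<delta> c by (simp add: \<epsilon>_def)
    obtain r where r: "1/2 \<le> r" "r < 1"
      and k: "\<And>u v::'a. norm u = 1 \<Longrightarrow> norm v = 1 \<Longrightarrow>
          ereal (riesz_profile s (r * (u \<bullet> v)) - \<epsilon>) \<le> riesz_kernel s u v"
        "I - \<epsilon> < dilated_energy TYPE('a) s r"
      using obtain_dilation[OF dim s \<epsilon>] unfolding I_def by blast
    obtain A B where AB: "\<And>N. N \<ge> m \<Longrightarrow>
        (\<Sum>i=1..N. \<Sum>j=1..N. riesz_profile s (r * (x i \<bullet> x j))) \<le>
        (I + \<epsilon>) * (real N)\<^sup>2 + A + B * real N"
      using greedy_discrete_energy_le[OF dim s(2) g, of "\<lambda>t. riesz_profile s (r * t)" \<epsilon>] k(1)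
      unfolding I_def by blast
    have "(\<lambda>N. A / (real N)\<^sup>2 + B / real N) \<longlonglongrightarrow> 0" by real_asymp
    then have "\<forall>\<^sub>F N in sequentially. A / (real N)\<^sup>2 + B / real N < \<epsilon>"
      using \<epsilon> by (rule order_tendstoD)
    with eventually_ge_at_top[of m] eventually_ge_at_top[of 1]
    have "\<forall>\<^sub>F N in sequentially. moment_defect x N n < \<delta>"
    proof eventually_elim
      case (elim N)
      have "(1/2) ^ n \<le> r ^ n" using r by (intro power_mono) auto
      then have "c * moment_defect x N n \<le> riesz_coeff s n * r ^ n * moment_defect x N n"
        unfolding c_def using False riesz_coeff_pos[OF s(1), of n]
        by (intro mult_right_mono mult_left_mono moment_defect_nonneg) auto
      also have "\<dots> \<le> (\<Sum>i=1..N. \<Sum>j=1..N. riesz_profile s (r * (x i \<bullet> x j))) / (real N)\<^sup>2 -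
          dilated_energy TYPE('a) s (r)"
        using r False elim by (intro moment_defect_le_energy_gap s x) auto
      also have "\<dots> \<le> ((I + \<epsilon>) * (real N)\<^sup>2 + A + B * real N) / (real N)\<^sup>2 - (I - \<epsilon>)"
        using AB[of N] k(2) elim by (intro diff_mono divide_right_mono) auto
      also have "\<dots> = 2 * \<epsilon> + (A / (real N)\<^sup>2 + B / real N)"
        using elim by (simp add: field_simps power2_eq_square)
      also have "\<dots> < 3 * \<epsilon>" using elim by simp
      also have "\<dots> < c * \<delta>" using \<delta> c by (simp add: \<epsilon>_def)
      finally show ?case using c by simp
    qed
    then show "\<exists>no. \<forall>N\<ge>no. norm (moment_defect x N n - 0) < \<delta>"
      by (simp add: eventually_sequentially moment_defect_nonneg)
  qed
qed

section \<open>Consequences of vanishing moment defects\<close>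

lemma moment_defect_uniformly_distributed:
  fixes x :: "nat \<Rightarrow> 'a::euclidean_space"
  assumes x: "\<And>n. n \<ge> 1 \<Longrightarrow> norm (x n) = 1"
    and lim: "\<And>n. (\<lambda>N. moment_defect x N n) \<longlonglongrightarrow> 0"
  shows "uniformly_distributed x"
proof (rule uniformly_distributedI[OF x])
  fix w :: "'a list" assume w: "set w \<subseteq> Basis"
  then have "w \<in> words (length w)" by (simp add: words_def)
  define e where "e N = mean x N (word_monomial w) - sphere_int (word_monomial w)" for N
  have "(e N)\<^sup>2 \<le> moment_defect x N (length w)" for N
  proof -
    have "(\<Sum>v\<in>{w}. (mean x N (word_monomial v) - sphere_int (word_monomial v))\<^sup>2) \<le> moment_defect x N (length w)"
      unfolding moment_defect_def using \<open>w \<in> words (length w)\<close> by (intro sum_mono2) auto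
    then show ?thesis by (simp add: e_def)
  qed
  then have "(\<lambda>N. (e N)\<^sup>2) \<longlonglongrightarrow> 0"
    by (intro tendsto_sandwich[OF _ _ tendsto_const lim[of "length w"]] always_eventually) auto
  from tendsto_real_sqrt[OF this] have "(\<lambda>N. \<bar>e N\<bar>) \<longlonglongrightarrow> 0" by simp
  then have "e \<longlonglongrightarrow> 0" by (rule tendsto_rabs_zero_cancel)
  then show "(\<lambda>N. mean x N (word_monomial w)) \<longlonglongrightarrow> sphere_int (word_monomial w)"
    unfolding e_def by (simp add: LIM_zero_iff)
qed

text \<open>The deviation is at most the sum over \<open>n\<close> of
  \<open>M n * sqrt (moment_defect x N n)\<close>, a bound without \<open>u\<close>. Each term
  vanishes in the limit and is dominated by the summable \<open>M n\<close>, so Tannery's theorem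
  applies.\<close>

lemma mean_dilated_profile_uniform_lower_bound:
  fixes x :: "nat \<Rightarrow> 'a::euclidean_space"
  assumes r: "0 \<le> r" "r < 1" and x: "\<And>n. n \<ge> 1 \<Longrightarrow> norm (x n) = 1"
    and lim: "\<And>n. (\<lambda>N. moment_defect x N n) \<longlonglongrightarrow> 0" and \<epsilon>: "\<epsilon> > 0"
  shows "\<forall>\<^sub>F N in sequentially. \<forall>u. norm u = 1 \<longrightarrow>
    dilated_energy TYPE('a) s r - \<epsilon> < mean x N (\<lambda>v. riesz_profile s (r * (u \<bullet> v)))"
proof -
  define M where "M n = \<bar>riesz_coeff s n\<bar> * \<bar>r\<bar> ^ n" for n
  define a where "a n N = M n * sqrt (moment_defect x N n)" for n N
  have M: "summable M" "\<And>n. 0 \<le> M n"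
    unfolding M_def using r by (intro summable_riesz_coeff) auto
  have bound: "norm (a n N) \<le> M n" if "N \<ge> 1" for n N
    using mult_left_mono[of "sqrt (moment_defect x N n)" 1 "M n"] moment_defect_le_1[of x N n] x M that
    by (simp add: a_def moment_defect_nonneg abs_mult)
  have "\<forall>\<^sub>F (n, N) in at_top \<times>\<^sub>F sequentially. norm (a n N) \<le> M n"
    unfolding eventually_prod_filter using bound eventually_ge_at_top[of "1::nat"]
    by (intro exI[of _ "\<lambda>_. True"] exI[of _ "\<lambda>N. N \<ge> 1"]) auto
  moreover have "(\<lambda>N. a n N) \<longlonglongrightarrow> M n * sqrt 0" for n
    unfolding a_def by (intro tendsto_intros lim)
  ultimately have "(\<lambda>N. \<Sum>n. a n N) \<longlonglongrightarrow> (\<Sum>n. M n * sqrt 0)"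
    using tannerys_theorem[of a "\<lambda>n. M n * sqrt 0" sequentially M] M by simp
  then have "\<forall>\<^sub>F N in sequentially. (\<Sum>n. a n N) < \<epsilon>"
    using \<epsilon> by (intro order_tendstoD) auto
  with eventually_ge_at_top[of 1] show ?thesis
  proof eventually_elim
    case (elim N)
    show ?case
    proof (intro allI impI)
      fix u :: 'a assume u: "norm u = 1"
      have "(\<lambda>n. mean x N (\<lambda>v. riesz_coeff s n * (r * (u \<bullet> v)) ^ n)) sums
          mean x N (\<lambda>v. riesz_profile s (r * (u \<bullet> v)))"
      proof (intro sums_divide sums_sum riesz_profile_sums)
        fix j assume "j \<in> {1..N}"
        then have "\<bar>u \<bullet> x j\<bar> \<le> 1" using x u by (intro inner_sphere_bounds) auto
        then show "\<bar>r * (u \<bullet> x j)\<bar> < 1"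
          using r mult_left_mono[of "\<bar>u \<bullet> x j\<bar>" 1 r] by (simp add: abs_mult)
      qed
      moreover have "mean x N (\<lambda>v. riesz_coeff s n * (r * (u \<bullet> v)) ^ n) =
          riesz_coeff s n * r ^ n * mean x N (\<lambda>v. (u \<bullet> v) ^ n)" for n
        by (simp add: power_mult_distrib sum_distrib_left mult.assoc)
      ultimately have "(\<lambda>n. riesz_coeff s n * r ^ n * mean x N (\<lambda>v. (u \<bullet> v) ^ n)) sums
          mean x N (\<lambda>v. riesz_profile s (r * (u \<bullet> v)))" by (simp only:)
      from sums_diff[OF dilated_energy(2)[OF r u, of s] this]
      have 1: "(\<lambda>n. riesz_coeff s n * r ^ n * (sphere_moment TYPE('a) n - mean x N (\<lambda>v. (u \<bullet> v) ^ n))) sums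
          (dilated_energy TYPE('a) s r - mean x N (\<lambda>v. riesz_profile s (r * (u \<bullet> v))))"
        by (simp add: right_diff_distrib)
      have "riesz_coeff s n * r ^ n * (sphere_moment TYPE('a) n - mean x N (\<lambda>v. (u \<bullet> v) ^ n)) \<le> a n N" for n
      proof -
        have "riesz_coeff s n * r ^ n * (sphere_moment TYPE('a) n - mean x N (\<lambda>v. (u \<bullet> v) ^ n)) \<le>
            M n * \<bar>mean x N (\<lambda>v. (u \<bullet> v) ^ n) - sphere_moment TYPE('a) n\<bar>"
          by (rule order_trans[OF abs_ge_self])
             (simp only: M_def abs_mult power_abs abs_minus_commute order_refl)
        also have "\<dots> \<le> a n N"
          unfolding a_def by (intro mult_left_mono mean_inner_power_le u M)
        finally show ?thesis .
      qed
      moreover have "summable (\<lambda>n. a n N)"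
        using bound elim by (intro summable_comparison_test'[OF M(1)]) auto
      ultimately have "dilated_energy TYPE('a) s r - mean x N (\<lambda>v. riesz_profile s (r * (u \<bullet> v))) \<le>
          (\<Sum>n. a n N)"
        using 1 by (intro sums_le[OF _ 1 summable_sums])
      with elim show "dilated_energy TYPE('a) s r - \<epsilon> < mean x N (\<lambda>v. riesz_profile s (r * (u \<bullet> v)))"
        by simp
    qed
  qed
qed

theorem corollary2p2:
  fixes d m :: nat and s :: real and x :: "nat \<Rightarrow> 'a::euclidean_space"
  assumes "d \<ge> 1" and "DIM('a) = d + 1"
    and "- 2 < s" and "s < real d"
    and "m \<ge> 1"
    and "greedy_sequence (riesz_kernel s) m x"
  shows "uniformly_distributed x \<and>
    (\<lambda>N. polarization (riesz_kernel s) x N / ereal (real N))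
      \<longlonglongrightarrow> ereal (riesz_energy TYPE('a) s)"
proof
  define I where "I = riesz_energy TYPE('a) s"
  have dim: "DIM('a) \<ge> 2" and s: "s < real (DIM('a) - 1)"
    using assms by simp_all
  have x: "norm (x n) = 1" if "n \<ge> 1" for n
    using assms(6) that by (auto simp: greedy_sequence_def)
  note lim = moment_defect_tendsto_0[OF dim assms(3) s assms(6)]
  show "uniformly_distributed x"
    by (rule moment_defect_uniformly_distributed) (use x lim in auto)
  show "(\<lambda>N. polarization (riesz_kernel s) x N / ereal (real N)) \<longlonglongrightarrow> ereal (riesz_energy TYPE('a) s)"
    unfolding I_def[symmetric]
  proof (rule order_tendstoI)
    fix a assume "a < ereal I"
    then obtain z where z: "a < ereal z" "z < I"
      using ereal_dense2 by fastforce
    \<comment> \<open>So \<open>z = I - 3 * \<epsilon>\<close>: one part is lost in the dilated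
      energy, one in the uniform lower bound and one in the kernel comparison.\<close>
    define \<epsilon> where "\<epsilon> = (I - z) / 3"
    have \<epsilon>: "\<epsilon> > 0" using z by (simp add: \<epsilon>_def)
    obtain r where r: "1/2 \<le> r" "r < 1"
      and k: "\<And>u v::'a. norm u = 1 \<Longrightarrow> norm v = 1 \<Longrightarrow>
          ereal (riesz_profile s (r * (u \<bullet> v)) - \<epsilon>) \<le> riesz_kernel s u v"
        "I - \<epsilon> < dilated_energy TYPE('a) s r"
      using obtain_dilation[OF dim assms(3) s \<epsilon>] unfolding I_def by blast
    from r have rk: "0 \<le> r" "r < 1" by auto
    have "\<forall>\<^sub>F N in sequentially. \<forall>u. norm u = 1 \<longrightarrow>
        dilated_energy TYPE('a) s (r) - \<epsilon> < mean x N (\<lambda>v. riesz_profile s (r * (u \<bullet> v)))"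
      by (rule mean_dilated_profile_uniform_lower_bound) (use rk x lim \<epsilon> in auto)
    from this eventually_ge_at_top[of 1]
    show "\<forall>\<^sub>F N in sequentially. a < polarization (riesz_kernel s) x N / ereal (real N)"
    proof eventually_elim
      case (elim N)
      have "ereal (real N * z) \<le> potential (riesz_kernel s) x N u" if "u \<in> unit_sphere" for u
      proof -
        have u: "norm u = 1" using that by simp
        have "z + \<epsilon> < mean x N (\<lambda>v. riesz_profile s (r * (u \<bullet> v)))"
          using elim(1) u k(2) by (auto simp: \<epsilon>_def field_simps)
        then have "real N * z \<le> (\<Sum>j=1..N. riesz_profile s (r * (u \<bullet> x j)) - \<epsilon>)"
          using elim(2) by (simp add: sum_subtractf field_simps)
        moreover have "ereal (\<Sum>j=1..N. riesz_profile s (r * (u \<bullet> x j)) - \<epsilon>) \<le>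
            potential (riesz_kernel s) x N u"
          by (rule potential_ge[where k = "\<lambda>t. riesz_profile s (r * t) - \<epsilon>"]) (use k(1) x u in auto)
        ultimately show ?thesis by (metis ereal_less_eq(3) order_trans)
      qed
      then have "ereal (real N) * ereal z \<le> polarization (riesz_kernel s) x N"
        unfolding polarization_def by (intro INF_greatest) simp
      then have "ereal z \<le> polarization (riesz_kernel s) x N / ereal (real N)"
        using elim by (subst ereal_le_divide_pos) auto
      with z(1) show ?case by (rule less_le_trans)
    qed
  next
    \<comment> \<open>The upper bound is the averaging estimate, valid for each
      \<open>N \<ge> 1\<close>.\<close>
    fix a assume a: "ereal I < a"
    show "\<forall>\<^sub>F N in sequentially. polarization (riesz_kernel s) x N / ereal (real N) < a"
      using eventually_ge_at_top[of 1]
    proof eventually_elim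
      case (elim N)
      have "polarization (riesz_kernel s) x N / ereal (real N) \<le> ereal I"
        using elim polarization_le_energy[OF dim s, of x N] x unfolding I_def
        by (subst ereal_divide_le_pos) auto
      then show ?case using a by (rule le_less_trans)
    qed
  qed
qed

end
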